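(* There exists an absolute constant $C$ such that for every signed graph $\Gamma=(G,\sigma)$ on $N$ vertices and every $k\in\{1,2,\dots,N\}$, $$\frac{\lambda_k(L^{\sigma})}{2}\leq h_k^{\sigma}(\mu_1)\leq Ck^3\sqrt{d_{\max}\lambda_k(L^{\sigma})},$$ where $d_{\max}=\max_{u\in V}d_u$.
   Context: A signed graph $\Gamma=(G,\sigma)$ consists of a finite simple undirected graph $G=(V,E)$ with $N=|V|$ vertices, positive symmetric edge weights $w_{uv}>0$ for $\{u,v\}\in E$ ($w_{uv}=0$ otherwise), and a signature $\sigma:E\to\{+1,-1\}$; write $\sigma(uv)=\sigma(\{u,v\})$. The degree is $d_u=\sum_v w_{uv}$, $D=\mathrm{diag}(d_u)$, $A^{\sigma}_{uv}=\sigma(uv)w_{uv}$ for edges and $0$ otherwise, and $L^\sigma=D-A^\sigma$ with eigenvalues $\lambda_1(L^\sigma)\le\cdots\le\lambda_N(L^\sigma)$. $\mu_1\equiv 1$ on $V$; for a positive measure $\mu$, $\mathrm{vol}_\mu(S)=\sum_{u\in S}\mu(u)$. For $V_1,V_2\subseteq V$, $|E(V_1,V_2)|=\sum_{u\in V_1}\sum_{v\in V_2}w_{uv}$, $|E^{\pm}(V_1,V_2)|=\sum_{u\in V_1}\sum_{v\in V_2,\sigma(uv)=\pm1}w_{uv}$, $|E^\pm(V_1)|=|E^\pm(V_1,V_1)|$. A sub-bipartition $(V_1,V_2)$ is a pair of disjoint subsets with $V_1\cup V_2\ne\emptyset$, and $$\beta^{\sigma}(V_1,V_2)=\frac{2|E^{+}(V_1,V_2)|+|E^-(V_1)|+|E^-(V_2)|+|E(V_1\cup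 V_2,\overline{V_1\cup V_2})|}{\mathrm{vol}_{\mu}(V_1\cup V_2)}.$$ $h^{\sigma}_k(\mu)$ is the minimum of $\max_{1\le i\le k}\beta^{\sigma}(V_{2i-1},V_{2i})$ over all $k$-tuples of sub-bipartitions $(V_1,V_2),\dots,(V_{2k-1},V_{2k})$ with $V_1\cup V_2,\dots,V_{2k-1}\cup V_{2k}$ pairwise disjoint. *)

theory Defs
  imports Complex_Main "Jordan_Normal_Form.Char_Poly"
begin

text \<open>
  Weighted signed graphs on the vertex set \<open>{..<N}\<close>, where \<open>N\<close> is \<open>nverts\<close>. An edge is a
  two-element set of vertices, and only the values of the signature on edges matter.
\<close>

record wsgraph =
  nverts :: nat
  edges :: "nat set set"
  weight :: "nat \<Rightarrow> nat \<Rightarrow> real"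
  signature :: "nat set \<Rightarrow> int"

abbreviation verts :: "wsgraph \<Rightarrow> nat set" where
  "verts \<Gamma> \<equiv> {..<nverts \<Gamma>}"

definition signed_graph :: "wsgraph \<Rightarrow> bool" where
  "signed_graph \<Gamma> \<longleftrightarrow>
     edges \<Gamma> \<subseteq> {{u, v} |u v. u \<in> verts \<Gamma> \<and> v \<in> verts \<Gamma> \<and> u \<noteq> v} \<and>
     (\<forall>u v. weight \<Gamma> u v = weight \<Gamma> v u) \<and>
     (\<forall>u v. {u, v} \<in> edges \<Gamma> \<longrightarrow> weight \<Gamma> u v > 0) \<and>
     (\<forall>u v. {u, v} \<notin> edges \<Gamma> \<longrightarrow> weight \<Gamma> u v = 0) \<and>
     (\<forall>e \<in> edges \<Gamma>. signature \<Gamma> e \<in> {1, -1})"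

definition deg :: "wsgraph \<Rightarrow> nat \<Rightarrow> real" where
  "deg \<Gamma> u = (\<Sum>v\<in>verts \<Gamma>. weight \<Gamma> u v)"

definition max_deg :: "wsgraph \<Rightarrow> real" where
  "max_deg \<Gamma> = Max (deg \<Gamma> ` verts \<Gamma>)"

definition degree_mat :: "wsgraph \<Rightarrow> real mat" where
  "degree_mat \<Gamma> = mat (nverts \<Gamma>) (nverts \<Gamma>) (\<lambda>(u, v). if u = v then deg \<Gamma> u else 0)"

definition signed_adjacency :: "wsgraph \<Rightarrow> real mat" where
  "signed_adjacency \<Gamma> = mat (nverts \<Gamma>) (nverts \<Gamma>)
     (\<lambda>(u, v). if {u, v} \<in> edges \<Gamma> then real_of_int (signature \<Gamma> {u, v}) * weight \<Gamma> u v else 0)"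

definition signed_laplacian :: "wsgraph \<Rightarrow> real mat" where
  "signed_laplacian \<Gamma> = degree_mat \<Gamma> - signed_adjacency \<Gamma>"

text \<open>
  The \<open>k\<close>-th smallest eigenvalue, counted with multiplicity and with \<open>k\<close> starting at 1. Only
  real eigenvalues are listed, which for a real symmetric matrix are all of them.
\<close>

definition nth_eigenvalue :: "nat \<Rightarrow> real mat \<Rightarrow> real" where
  "nth_eigenvalue k M = sorted_list_of_multiset (proots (char_poly M)) ! (k - 1)"

definition vol :: "(nat \<Rightarrow> real) \<Rightarrow> nat set \<Rightarrow> real" where
  "vol \<mu> S = (\<Sum>u\<in>S. \<mu> u)"

definition edge_weight :: "wsgraph \<Rightarrow> nat set \<Rightarrow> nat set \<Rightarrow> real" where
  "edge_weight \<Gamma> A B = (\<Sum>u\<in>A. \<Sum>v\<in>B. weight \<Gamma> u v)"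

definition signed_edge_weight :: "wsgraph \<Rightarrow> int \<Rightarrow> nat set \<Rightarrow> nat set \<Rightarrow> real" where
  "signed_edge_weight \<Gamma> s A B =
     (\<Sum>u\<in>A. \<Sum>v\<in>{v\<in>B. {u, v} \<in> edges \<Gamma> \<and> signature \<Gamma> {u, v} = s}. weight \<Gamma> u v)"

definition sub_bipartition :: "wsgraph \<Rightarrow> nat set \<Rightarrow> nat set \<Rightarrow> bool" where
  "sub_bipartition \<Gamma> A B \<longleftrightarrow>
     A \<subseteq> verts \<Gamma> \<and> B \<subseteq> verts \<Gamma> \<and> A \<inter> B = {} \<and> A \<union> B \<noteq> {}"

definition bipartiteness_ratio ::
    "wsgraph \<Rightarrow> (nat \<Rightarrow> real) \<Rightarrow> nat set \<Rightarrow> nat set \<Rightarrow> real" where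
  "bipartiteness_ratio \<Gamma> \<mu> A B =
     (2 * signed_edge_weight \<Gamma> 1 A B + signed_edge_weight \<Gamma> (-1) A A
        + signed_edge_weight \<Gamma> (-1) B B
        + edge_weight \<Gamma> (A \<union> B) (verts \<Gamma> - (A \<union> B)))
     / vol \<mu> (A \<union> B)"

text \<open>
  A \<open>k\<close>-tuple of sub-bipartitions is a family \<open>V\<close> of which only \<open>V 1, \<dots>, V (2 * k)\<close> matter.
  For \<open>k\<close> between 1 and the number of vertices, the set under \<open>Min\<close> below is nonempty, and it is
  finite because each value is one of the finitely many ratios.
\<close>

definition sub_bipartition_family :: "wsgraph \<Rightarrow> nat \<Rightarrow> (nat \<Rightarrow> nat set) \<Rightarrow> bool" where
  "sub_bipartition_family \<Gamma> k V \<longleftrightarrow>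
     (\<forall>i\<in>{1..k}. sub_bipartition \<Gamma> (V (2 * i - 1)) (V (2 * i))) \<and>
     (\<forall>i\<in>{1..k}. \<forall>j\<in>{1..k}. i \<noteq> j \<longrightarrow>
        (V (2 * i - 1) \<union> V (2 * i)) \<inter> (V (2 * j - 1) \<union> V (2 * j)) = {})"

definition cheeger :: "wsgraph \<Rightarrow> (nat \<Rightarrow> real) \<Rightarrow> nat \<Rightarrow> real" where
  "cheeger \<Gamma> \<mu> k =
     Min {Max ((\<lambda>i. bipartiteness_ratio \<Gamma> \<mu> (V (2 * i - 1)) (V (2 * i))) ` {1..k}) | V.
            sub_bipartition_family \<Gamma> k V}"

end

theory Submission
  imports Defs "HOL-Analysis.L2_Norm"
begin

text \<open>
  The lower bound is the variational principle: the signed indicators of \<open>k\<close> disjoint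
  sub-bipartitions span a \<open>k\<close>-dimensional space on which the Rayleigh quotient is at most twice
  the largest ratio.

  For the upper bound, the first \<open>k\<close> orthonormal eigenvectors embed the vertices into \<open>\<real>\<^sup>k\<close>.
  The directions of the image points, taken up to sign, are partitioned by a cubical grid of mesh
  \<open>s = 1 / (12 k)\<close> that is symmetric about the origin. Among \<open>M = 16 k\<^sup>2\<close> shifts of the
  grid there is, separately in each coordinate, one that loses little mass near the grid
  hyperplanes and for which the cutoff functions of the cells have little energy. No cell has
  mass much above 1, so the cells can be grouped into \<open>k\<close> regions of mass at least \<open>1/2\<close>.
  Cutting off the embedding to these regions yields \<open>k\<close> disjointly supported functions with
  Rayleigh quotient \<open>O(k\<^sup>5 \<lambda>\<^sub>k)\<close>, and a superlevel set of the square of each of them, split by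
  sign, is a sub-bipartition of the required ratio by Cheeger's argument.
\<close>

section \<open>The spectral theorem for real symmetric matrices\<close>

text \<open>Producing all \<open>k\<close> regions, and not just a fixed fraction of them, leaves
  little room in a total mass of \<open>k\<close>. If a cell may weigh b, the first k - 1 groups may
  use up (k - 1) b, so b may exceed 1 only by O(1/k), and the mass lost near the grid hyperplanes
  must stay below a constant. The first demand fixes the mesh: a cell has squared diameter of order
  k s^2, which has to be O(1/k). The second fixes the number of shifts: each coordinate loses at
  most 2k/M, and there are k coordinates. Narrow ramps are steep, but averaging over the shifts
  charges M / s^2 instead of (M / s)^2 for the squared slope. Applied to a total energy of order k
  \<lambda>, this gives the fifth power of k, whose square root stays below the cube. Mass loss and
  energy are both bounded by sums over coordinates, so the shift of each coordinate can be chosen on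
  its own, without any joint or random choice.\<close>

lemma Householder:
  fixes v :: "real vec"
  assumes v: "v \<in> carrier_vec (Suc n)" and unit: "v \<bullet> v = 1"
  obtains H where "H \<in> carrier_mat (Suc n) (Suc n)" "H\<^sup>T = H" "H * H = 1\<^sub>m (Suc n)" "col H 0 = v"
proof -
  \<comment> \<open>\<open>H\<close> is the reflection with normal \<open>w\<close> that exchanges
    the first unit vector and \<open>v\<close>. If \<open>v\<close> already is that unit vector,
    then \<open>q = 0\<close> and division by zero turns \<open>H\<close> into the identity.\<close>
  define w where "w i = v $ i - (if i = 0 then 1 else 0)" for i
  define q where "q = (\<Sum>i<Suc n. (w i)\<^sup>2)"
  define H where "H = mat (Suc n) (Suc n)
    (\<lambda>(i, j). (if i = j then 1 else 0) - 2 * w i * w j / q)"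
  have H: "H \<in> carrier_mat (Suc n) (Suc n)" by (simp add: H_def)
  have "(\<Sum>i<Suc n. (v $ i)\<^sup>2) = 1"
    using unit v by (simp add: scalar_prod_def power2_eq_square atLeast0LessThan)
  then have q: "q = - 2 * w 0"
    by (simp add: q_def w_def sum.lessThan_Suc_shift power2_eq_square algebra_simps del: sum.lessThan_Suc)
  have "col H 0 = v"
  proof
    fix i assume i: "i < dim_vec v"
    have "w i = 0" if "q = 0"
    proof -
      have "\<forall>i\<in>{..<Suc n}. (w i)\<^sup>2 = 0"
        using that unfolding q_def by (subst (asm) sum_nonneg_eq_0_iff) auto
      then show ?thesis using i v by auto
    qed
    then have "2 * w i * w 0 / q = - w i" using q by auto
    then show "col H 0 $ i = v $ i"
      using i v by (auto simp: H_def w_def)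
  qed (use v in \<open>simp add: H_def\<close>)
  moreover have "H * H = 1\<^sub>m (Suc n)"
  proof
    fix i j assume ij: "i < dim_row (1\<^sub>m (Suc n))" "j < dim_col (1\<^sub>m (Suc n))"
    let ?d = "\<lambda>i j. if i = j then 1 else (0::real)"
    have delta: "(\<Sum>l<Suc n. ?d i l * g l) = g i" "(\<Sum>l<Suc n. ?d l j * g l) = g j" for g :: "nat \<Rightarrow> real"
      using ij by (auto simp: if_distrib[of "\<lambda>x. x * _"] sum.delta sum.delta' simp del: sum.lessThan_Suc cong: if_cong)
    have "(H * H) $$ (i, j) = (\<Sum>l<Suc n. (?d i l - 2 * w i * w l / q) * (?d l j - 2 * w l * w j / q))"
      using ij by (simp add: H_def scalar_prod_def atLeast0LessThan del: sum.lessThan_Suc)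
    also have "\<dots> = (\<Sum>l<Suc n. ?d i l * ?d l j - ?d i l * (2 * w l * w j / q) - ?d l j * (2 * w i * w l / q)
        + 4 * w i * w j / q\<^sup>2 * (w l)\<^sup>2)"
      by (rule sum.cong) (auto simp: power2_eq_square algebra_simps)
    also have "\<dots> = ?d i j - 2 * w i * w j / q - 2 * w i * w j / q + 4 * w i * w j / q\<^sup>2 * q"
      using ij by (simp only: sum.distrib sum_subtractf sum_distrib_left[symmetric] q_def[symmetric] delta lessThan_iff
          index_one_mat dim_row_mat dim_col_mat) 
    also have "\<dots> = ?d i j"
      by (simp add: power2_eq_square)
    finally show "(H * H) $$ (i, j) = 1\<^sub>m (Suc n) $$ (i, j)" using ij by simp
  qed (simp_all add: H_def)
  moreover have "H\<^sup>T = H"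
    by (rule eq_matI) (auto simp: H_def mult.commute)
  ultimately show ?thesis using that H by blast
qed

text \<open>The number \<open>z\<close> times the squared norm of \<open>v\<close> is the Hermitian
  form of \<open>A\<close> at \<open>v\<close>, which for a real symmetric matrix equals its own
  conjugate.\<close>

lemma real_symmetric_eigenvalue_real:
  fixes A :: "real mat"
  assumes A: "A \<in> carrier_mat n n" and sym: "A\<^sup>T = A"
    and ev: "eigenvalue (map_mat complex_of_real A) z"
  shows "z \<in> \<real>"
proof -
  let ?A = "map_mat complex_of_real A"
  have A': "?A \<in> carrier_mat n n" using A by simp
  obtain v where v: "v \<in> carrier_vec n" "v \<noteq> 0\<^sub>v n" and Av: "?A *\<^sub>v v = z \<cdot>\<^sub>v v"
    using ev A unfolding eigenvalue_def eigenvector_def by auto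
  have row: "(\<Sum>j<n. A $$ (i, j) * v $ j) = z * v $ i" if "i < n" for i
  proof -
    have "(?A *\<^sub>v v) $ i = (\<Sum>j<n. A $$ (i, j) * v $ j)"
      using that A v by (auto simp: scalar_prod_def atLeast0LessThan)
    then show ?thesis using that v by (simp add: Av)
  qed
  have sA: "A $$ (i, j) = A $$ (j, i)" if "i < n" "j < n" for i j
    using that A sym by (metis carrier_matD index_transpose_mat(1))
  define q where "q = (\<Sum>i<n. cnj (v $ i) * v $ i)"
  have eq: "z * q = (\<Sum>i<n. \<Sum>j<n. A $$ (i, j) * (cnj (v $ i) * v $ j))"
  proof -
    have "z * q = (\<Sum>i<n. cnj (v $ i) * (z * v $ i))"
      unfolding q_def by (simp add: sum_distrib_left algebra_simps)
    also have "\<dots> = (\<Sum>i<n. cnj (v $ i) * (\<Sum>j<n. A $$ (i, j) * v $ j))"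
      by (rule sum.cong) (simp_all add: row)
    finally show ?thesis by (simp add: sum_distrib_left algebra_simps)
  qed
  have "cnj (z * q) = z * q"
    unfolding eq by (subst (2) sum.swap) (auto simp: sA algebra_simps intro!: sum.cong)
  moreover have q': "q = complex_of_real (\<Sum>i<n. (cmod (v $ i))\<^sup>2)"
    unfolding q_def of_real_sum by (rule sum.cong) (auto simp: complex_norm_square mult.commute simp del: of_real_power)
  moreover have "q \<noteq> 0"
  proof
    assume "q = 0"
    then have "complex_of_real (\<Sum>i<n. (cmod (v $ i))\<^sup>2) = complex_of_real 0" unfolding q' by simp
    then have "(\<Sum>i<n. (cmod (v $ i))\<^sup>2) = 0" unfolding of_real_eq_iff .
    then have "\<forall>i\<in>{..<n}. (cmod (v $ i))\<^sup>2 = 0" by (subst (asm) sum_nonneg_eq_0_iff) auto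
    then have "v = 0\<^sub>v n" using v(1) by auto
    then show False using v(2) by simp
  qed
  moreover have "cnj q = q" unfolding q' by simp
  ultimately have "cnj z = z" by simp
  then show ?thesis by (simp add: Reals_cnj_iff)
qed

text \<open>Over the complex numbers the polynomial splits and all its roots are real; injectivity
  of the embedding of the reals carries the factorization back.\<close>

lemma real_symmetric_char_poly_splits:
  fixes A :: "real mat"
  assumes A: "A \<in> carrier_mat n n" and sym: "A\<^sup>T = A"
  shows "\<exists>es. char_poly A = (\<Prod>e\<leftarrow>es. [:- e, 1:])"
proof -
  let ?A = "map_mat complex_of_real A"
  have A': "?A \<in> carrier_mat n n" using A by simp
  obtain as where as: "char_poly ?A = (\<Prod>a\<leftarrow>as. [:- a, 1:])"
    using char_poly_factorized[OF A'] by blast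
  have "a \<in> \<real>" if "a \<in> set as" for a
  proof (rule real_symmetric_eigenvalue_real[OF A sym])
    show "eigenvalue ?A a"
      unfolding eigenvalue_root_char_poly[OF A'] as
      using that by (auto simp: poly_prod_list prod_list_zero_iff)
  qed
  then have re: "map (\<lambda>a. complex_of_real (Re a)) as = as"
    by (intro map_idI) (auto simp: of_real_Re)
  interpret inj_comm_ring_hom complex_of_real by (unfold_locales) auto
  interpret p: map_poly_inj_comm_ring_hom complex_of_real ..
  have "map_poly complex_of_real (char_poly A) = char_poly ?A"
    by (rule of_real_hom.char_poly_hom[OF A, symmetric])
  also have "\<dots> = (\<Prod>a\<leftarrow>map (\<lambda>a. complex_of_real (Re a)) as. [:- a, 1:])"
    unfolding re by (rule as)
  also have "\<dots> = map_poly complex_of_real (\<Prod>e\<leftarrow>map Re as. [:- e, 1:])"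
    by (simp add: p.hom_prod_list o_def)
  finally show ?thesis using p.injectivity by blast
qed

text \<open>Deflation: a Householder reflection moves a unit eigenvector for \<open>e\<close> to a
  coordinate axis, and symmetry then splits off a 1 by 1 block whose complement has the
  characteristic polynomial without the factor of \<open>e\<close>. The order of \<open>es\<close>
  is prescribed so that a sorted list can be put on the diagonal.\<close>

lemma real_symmetric_diagonalization:
  fixes A :: "real mat"
  assumes "A \<in> carrier_mat n n" "A\<^sup>T = A" "char_poly A = (\<Prod>e\<leftarrow>es. [:- e, 1:])"
  shows "\<exists>P\<in>carrier_mat n n. P\<^sup>T * P = 1\<^sub>m n \<and>
    P\<^sup>T * A * P = mat n n (\<lambda>(i, j). if i = j then es ! i else 0)"
  using assms
proof (induction es arbitrary: n A)
  case Nil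
  with degree_monic_char_poly[OF Nil(1)] have "n = 0" by simp
  then show ?case by (intro bexI[of _ "1\<^sub>m 0"]) auto
next
  case (Cons e es)
  note A = Cons.prems(1) and sym = Cons.prems(2)
  have cp: "char_poly A = [:- e, 1:] * (\<Prod>e\<leftarrow>es. [:- e, 1:])" using Cons.prems by simp
  have mon: "monic (\<Prod>e\<leftarrow>es. [:- e, 1:])" by (rule monic_prod_list, auto)
  have "degree (char_poly A) = Suc (degree (\<Prod>e\<leftarrow>es. [:- e, 1:]))" unfolding cp
    by (subst degree_mult_eq, insert mon, auto)
  with degree_monic_char_poly[OF A] obtain m where n: "n = Suc m" by (cases n) auto
  have "eigenvalue A e" unfolding eigenvalue_root_char_poly[OF A] cp by simp
  then obtain u where u: "u \<in> carrier_vec n" "u \<noteq> 0\<^sub>v n" "A *\<^sub>v u = e \<cdot>\<^sub>v u"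
    using A unfolding eigenvalue_def eigenvector_def by auto
  have upos: "u \<bullet> u > 0"
  proof -
    have "u \<bullet> u = (\<Sum>i<n. (u $ i)\<^sup>2)"
      using u by (simp add: scalar_prod_def power2_eq_square atLeast0LessThan)
    moreover have "(\<Sum>i<n. (u $ i)\<^sup>2) \<noteq> 0"
    proof
      assume "(\<Sum>i<n. (u $ i)\<^sup>2) = 0"
      then have "\<forall>i\<in>{..<n}. (u $ i)\<^sup>2 = 0" by (subst (asm) sum_nonneg_eq_0_iff) auto
      then have "u = 0\<^sub>v n" using u(1) by auto
      then show False using u(2) by simp
    qed
    ultimately show ?thesis by (simp add: order.strict_iff_order sum_nonneg)
  qed
  define v where "v = (1 / sqrt (u \<bullet> u)) \<cdot>\<^sub>v u"
  have v: "v \<in> carrier_vec (Suc m)" using u n by (simp add: v_def)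
  have "v \<bullet> v = 1" using u(1) upos by (simp add: v_def)
  from Householder[OF v this] obtain H where
    H: "H \<in> carrier_mat n n" "H\<^sup>T = H" "H * H = 1\<^sub>m n" "col H 0 = v"
    unfolding n by blast
  have Av: "A *\<^sub>v v = e \<cdot>\<^sub>v v"
    using A u by (simp add: v_def mult_mat_vec smult_smult_assoc mult.commute)
  define A' where "A' = H * A * H"
  have A': "A' \<in> carrier_mat n n" using A H by (simp add: A'_def)
  have A'sym: "A'\<^sup>T = A'"
    using A H sym by (simp add: A'_def transpose_mult[of _ n n _ n] assoc_mult_mat[of _ n n _ n _ n])
  have unit_col: "M *\<^sub>v unit_vec n 0 = col M 0" if "M \<in> carrier_mat n n" for M :: "real mat"
    by (rule eq_vecI) (use that n in \<open>auto simp: scalar_prod_right_unit\<close>)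
  have "col A' 0 = A' *\<^sub>v unit_vec n 0" by (rule unit_col[OF A', symmetric])
  also have "\<dots> = (H * A) *\<^sub>v (H *\<^sub>v unit_vec n 0)"
    unfolding A'_def by (rule assoc_mult_mat_vec) (use A H in auto)
  also have "H *\<^sub>v unit_vec n 0 = v" using unit_col[OF H(1)] H(4) by simp
  also have "(H * A) *\<^sub>v v = H *\<^sub>v (e \<cdot>\<^sub>v v)"
    using A H v n by (subst assoc_mult_mat_vec[of _ n n _ n]) (auto simp: Av)
  also have "\<dots> = e \<cdot>\<^sub>v (H *\<^sub>v (H *\<^sub>v unit_vec n 0))"
    using H v n \<open>H *\<^sub>v unit_vec n 0 = v\<close> by (simp add: mult_mat_vec)
  also have "H *\<^sub>v (H *\<^sub>v unit_vec n 0) = (H * H) *\<^sub>v unit_vec n 0"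
    by (rule assoc_mult_mat_vec[symmetric]) (use H in auto)
  also have "\<dots> = unit_vec n 0" using H by simp
  finally have col0: "col A' 0 = e \<cdot>\<^sub>v unit_vec n 0" .
  have A'0: "A' $$ (i, 0) = (if i = 0 then e else 0)" "A' $$ (0, i) = (if i = 0 then e else 0)" if "i < n" for i
  proof -
    have "A' $$ (i, 0) = col A' 0 $ i" using that A' by simp
    then show *: "A' $$ (i, 0) = (if i = 0 then e else 0)" using that unfolding col0 by auto
    have "A' $$ (0, i) = A'\<^sup>T $$ (i, 0)" using that A' n by simp
    then show "A' $$ (0, i) = (if i = 0 then e else 0)" using * by (simp add: A'sym)
  qed
  define E where "E = mat 1 1 (\<lambda>(_, _). e)"
  define A3 where "A3 = mat m m (\<lambda>(i, j). A' $$ (Suc i, Suc j))"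
  have E: "E \<in> carrier_mat 1 1" and A3: "A3 \<in> carrier_mat m m" by (simp_all add: E_def A3_def)
  have block: "A' = four_block_mat E (0\<^sub>m 1 m) (0\<^sub>m m 1) A3"
    by (rule eq_matI) (use A' n in \<open>auto simp: four_block_mat_def E_def A3_def A'0\<close>)
  have A3sym: "A3\<^sup>T = A3"
  proof (rule eq_matI)
    fix i j assume ij: "i < dim_row A3" "j < dim_col A3"
    have "A' $$ (Suc j, Suc i) = A'\<^sup>T $$ (Suc i, Suc j)" using ij A' n A3 by simp
    then show "A3\<^sup>T $$ (i, j) = A3 $$ (i, j)" using ij by (simp add: A'sym A3_def)
  qed (simp_all add: A3_def)
  have "similar_mat A A'"
  proof (rule similar_matI)
    have "A = (H * H) * A * (H * H)" using A H by simp
    also have "\<dots> = H * A' * H" 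
      unfolding A'_def using A H(1) by (simp add: assoc_mult_mat[of _ n n _ n _ n])
    finally show "A = H * A' * H" .
  qed (use A A' H in auto)
  then have "char_poly A = char_poly A'" by (rule char_poly_similar)
  also have "\<dots> = char_poly E * char_poly A3"
    unfolding block by (rule char_poly_four_block_zeros_col) (use E A3 in auto)
  also have "char_poly E = [:- e, 1:]"
    by (subst char_poly_upper_triangular[OF E]) (auto simp: E_def diag_mat_def)
  finally have "char_poly A3 = (\<Prod>e\<leftarrow>es. [:- e, 1:])"
    unfolding cp by (simp only: mult_cancel_left) simp
  from Cons.IH[OF A3 A3sym this] obtain P3 where
    P3: "P3 \<in> carrier_mat m m" "P3\<^sup>T * P3 = 1\<^sub>m m"
      "P3\<^sup>T * A3 * P3 = mat m m (\<lambda>(i, j). if i = j then es ! i else 0)" by blast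
  define B where "B = four_block_mat (1\<^sub>m 1) (0\<^sub>m 1 m) (0\<^sub>m m 1) P3"
  have B: "B \<in> carrier_mat n n" 
    using four_block_carrier_mat[of "1\<^sub>m 1" 1 1 P3 m m] P3 by (simp add: B_def n)
  have BT: "B\<^sup>T = four_block_mat (1\<^sub>m 1) (0\<^sub>m 1 m) (0\<^sub>m m 1) P3\<^sup>T"
    unfolding B_def by (subst transpose_four_block_mat[of _ 1 1 _ m _ m]) (use P3 in auto)
  have BB: "B\<^sup>T * B = 1\<^sub>m n"
    unfolding BT unfolding B_def n using P3
    by (subst mult_four_block_mat[of _ 1 1 _ m _ m _ _ 1 _ m]) (auto simp: four_block_one_mat)
  have "B\<^sup>T * A' * B = four_block_mat E (0\<^sub>m 1 m) (0\<^sub>m m 1) (P3\<^sup>T * A3 * P3)"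
    unfolding BT block unfolding B_def using P3 E A3
    by (simp add: mult_four_block_mat[of _ 1 1 _ m _ m _ _ 1 _ m])
  also have "\<dots> = mat n n (\<lambda>(i, j). if i = j then (e # es) ! i else 0)"
    unfolding P3(3) by (rule eq_matI) (auto simp: four_block_mat_def E_def n nth_Cons')
  finally have BAB: "B\<^sup>T * A' * B = mat n n (\<lambda>(i, j). if i = j then (e # es) ! i else 0)" .
  have HB: "(H * B)\<^sup>T = B\<^sup>T * H" using H B by (simp add: transpose_mult[of _ n n _ n])
  have BT': "B\<^sup>T \<in> carrier_mat n n" using B by simp
  show ?case
  proof (intro bexI conjI)
    have "(H * B)\<^sup>T * (H * B) = B\<^sup>T * ((H * H) * B)"
      unfolding HB using H(1) B BT' by (simp add: assoc_mult_mat[of _ n n _ n _ n])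
    then show "(H * B)\<^sup>T * (H * B) = 1\<^sub>m n" using H B BB by simp
    have "(H * B)\<^sup>T * A * (H * B) = B\<^sup>T * A' * B"
      unfolding HB A'_def using H(1) A B BT' by (simp add: assoc_mult_mat[of _ n n _ n _ n])
    then show "(H * B)\<^sup>T * A * (H * B) = mat n n (\<lambda>(i, j). if i = j then (e # es) ! i else 0)"
      using BAB by simp
  qed (use H B in auto)
qed

lemma symmetric_spectral:
  fixes A :: "real mat"
  assumes A: "A \<in> carrier_mat n n" and sym: "A\<^sup>T = A"
  obtains e :: "nat \<Rightarrow> nat \<Rightarrow> real" where
    "\<And>i j. i < n \<Longrightarrow> j < n \<Longrightarrow> (\<Sum>u<n. e i u * e j u) = of_bool (i = j)"
    "\<And>u v. u < n \<Longrightarrow> v < n \<Longrightarrow> (\<Sum>i<n. e i u * e i v) = of_bool (u = v)"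
    "\<And>u v. u < n \<Longrightarrow> v < n \<Longrightarrow>
       A $$ (u, v) = (\<Sum>i<n. nth_eigenvalue (Suc i) A * (e i u * e i v))"
    "\<And>i j. i \<le> j \<Longrightarrow> j < n \<Longrightarrow> nth_eigenvalue (Suc i) A \<le> nth_eigenvalue (Suc j) A"
proof -
  obtain es0 where es0: "char_poly A = (\<Prod>e\<leftarrow>es0. [:- e, 1:])"
    using real_symmetric_char_poly_splits[OF A sym] by blast
  have "proots (char_poly A) = (\<Sum>e\<leftarrow>es0. {#e#})"
    unfolding es0 by (induction es0) (auto simp: proots_mult prod_list_zero_iff image_iff simp del: mult_pCons_left)
  also have "\<dots> = mset es0" by (induction es0) auto
  finally have proots: "proots (char_poly A) = mset es0" .
  \<comment> \<open>With the sorted list on the diagonal, column \<open>i\<close> of the orthogonal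
    matrix belongs to \<open>nth_eigenvalue (Suc i) A\<close>.\<close>
  define es where "es = sorted_list_of_multiset (proots (char_poly A))"
  have ev: "nth_eigenvalue (Suc i) A = es ! i" for i by (simp add: nth_eigenvalue_def es_def)
  have mset: "mset es = mset es0" by (simp add: es_def proots)
  have cp: "char_poly A = (\<Prod>e\<leftarrow>es. [:- e, 1:])"
    unfolding es0 prod_mset_prod_list[symmetric] mset_map mset ..
  obtain P where P: "P \<in> carrier_mat n n" "P\<^sup>T * P = 1\<^sub>m n"
    "P\<^sup>T * A * P = mat n n (\<lambda>(i, j). if i = j then es ! i else 0)"
    using real_symmetric_diagonalization[OF A sym cp] by blast
  have PT: "P\<^sup>T \<in> carrier_mat n n" using P by simp
  have PP: "P * P\<^sup>T = 1\<^sub>m n" using mat_mult_left_right_inverse[OF PT P(1,2)] .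
  define D where "D = mat n n (\<lambda>(i, j). if i = j then es ! i else 0)"
  have D: "D \<in> carrier_mat n n" by (simp add: D_def)
  have "A = (P * P\<^sup>T) * A * (P * P\<^sup>T)" using A by (simp add: PP)
  also have "\<dots> = P * (P\<^sup>T * A * P) * P\<^sup>T"
    using A P(1) PT by (simp add: assoc_mult_mat[of _ n n _ n _ n])
  finally have AD: "A = P * (D * P\<^sup>T)" unfolding P(3) D_def[symmetric]
    using P(1) PT D by (simp add: assoc_mult_mat[of _ n n _ n _ n])
  have len: "length es = n"
    using degree_linear_factors[of uminus es] degree_monic_char_poly[OF A] by (simp add: cp)
  show ?thesis
  proof (rule that[of "\<lambda>i u. P $$ (u, i)"])
    fix i j assume ij: "i < n" "j < n"
    show "(\<Sum>u<n. P $$ (u, i) * P $$ (u, j)) = of_bool (i = j)"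
      using arg_cong[OF P(2), of "\<lambda>M. M $$ (i, j)"] ij P(1)
      by (simp add: scalar_prod_def atLeast0LessThan)
    show "(\<Sum>l<n. P $$ (i, l) * P $$ (j, l)) = of_bool (i = j)"
      using arg_cong[OF PP, of "\<lambda>M. M $$ (i, j)"] ij P(1)
      by (simp add: scalar_prod_def atLeast0LessThan)
    have DP: "(D * P\<^sup>T) $$ (l, j) = es ! l * P $$ (j, l)" if "l < n" for l
      using that ij P(1) by (simp add: D_def scalar_prod_def atLeast0LessThan
          if_distrib[of "\<lambda>x. x * _"] sum.delta' cong: if_cong)
    have "A $$ (i, j) = (\<Sum>l<n. P $$ (i, l) * (D * P\<^sup>T) $$ (l, j))"
      using ij P(1) D by (subst AD) (simp add: scalar_prod_def atLeast0LessThan)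
    then show "A $$ (i, j) = (\<Sum>l<n. nth_eigenvalue (Suc l) A * (P $$ (i, l) * P $$ (j, l)))"
      by (simp add: DP ev algebra_simps)
  next
    fix i j assume "i \<le> j" "j < n"
    then show "nth_eigenvalue (Suc i) A \<le> nth_eigenvalue (Suc j) A"
      unfolding ev using len by (intro sorted_nth_mono) (auto simp: es_def)
  qed
qed

section \<open>Cheeger rounding on signed weighted graphs\<close>

text \<open>A discrete form of integrating over thresholds: \<open>x i\<close> is the integral of
  \<open>of_bool (x i > t)\<close> over \<open>t \<ge> 0\<close>, so a nonpositive weighted total
  needs a nonpositive layer below the maximum. If the bottom layer contributes positively, removing
  it makes the total negative and leaves fewer positive values.\<close>

lemma layer_cake:
  fixes c x :: "'a \<Rightarrow> real"
  assumes "finite I" "\<And>i. i \<in> I \<Longrightarrow> x i \<ge> 0" "\<exists>i\<in>I. x i > 0" "(\<Sum>i\<in>I. c i * x i) \<le> 0"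
  shows "\<exists>t\<ge>0. (\<exists>i\<in>I. x i > t) \<and> (\<Sum>i\<in>I. c i * of_bool (x i > t)) \<le> 0"
  using assms
proof (induction "card {i\<in>I. x i > 0}" arbitrary: x rule: less_induct)
  case less
  note fin = \<open>finite I\<close>
  show ?case
  proof (cases "(\<Sum>i\<in>I. c i * of_bool (x i > 0)) \<le> 0")
    case True
    then show ?thesis using less.prems(3) by (intro exI[of _ 0]) auto
  next
    case False
    define S where "S = {i\<in>I. x i > 0}"
    have S: "finite S" "S \<noteq> {}" using fin less.prems(3) by (auto simp: S_def)
    define m where "m = Min (x ` S)"
    have m: "m > 0" using S by (auto simp: m_def) (auto simp: S_def)
    have mle: "m \<le> x i" if "i \<in> S" for i using that S by (auto simp: m_def)
    have "m \<in> x ` S" using S by (simp add: m_def)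
    then obtain i0 where i0: "i0 \<in> S" "x i0 = m" by auto
    define y where "y i = (if x i > 0 then x i - m else 0)" for i
    have ypos: "y i \<ge> 0" if "i \<in> I" for i
      using mle[of i] that by (auto simp: y_def S_def)
    have "(\<Sum>i\<in>I. c i * y i) = (\<Sum>i\<in>I. c i * x i - m * (c i * of_bool (x i > 0)))"
      using less.prems(2) by (intro sum.cong) (force simp: y_def algebra_simps)+
    also have "\<dots> = (\<Sum>i\<in>I. c i * x i) - m * (\<Sum>i\<in>I. c i * of_bool (x i > 0))"
      by (simp add: sum_subtractf sum_distrib_left)
    also have "\<dots> < 0" using less.prems(4) False m by (smt (verit) mult_pos_pos)
    finally have neg: "(\<Sum>i\<in>I. c i * y i) < 0" .
    have ex: "\<exists>i\<in>I. y i > 0"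
    proof (rule ccontr)
      assume "\<not> ?thesis"
      then have "y i = 0" if "i \<in> I" for i using ypos[OF that] that by force
      then show False using neg by simp
    qed
    have "{i\<in>I. y i > 0} \<subset> S"
    proof
      show "{i\<in>I. y i > 0} \<subseteq> S" using m by (auto simp: y_def S_def split: if_splits)
      have "y i0 = 0" using i0 by (simp add: y_def)
      then show "{i\<in>I. y i > 0} \<noteq> S" using i0 by auto
    qed
    then have "card {i\<in>I. y i > 0} < card {i\<in>I. x i > 0}"
      using S by (simp add: S_def psubset_card_mono)
    from less.hyps[OF this fin ypos ex] neg obtain t where
      t: "t \<ge> 0" "\<exists>i\<in>I. y i > t" "(\<Sum>i\<in>I. c i * of_bool (y i > t)) \<le> 0" by auto
    have iff: "y i > t \<longleftrightarrow> x i > t + m" for i using t(1) m by (auto simp: y_def)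
    show ?thesis using t m unfolding iff by (intro exI[of _ "t + m"]) auto
  qed
qed

text \<open>Every pair has a sign, and weight 0 stands for a missing edge, so that sums run over all
  of \<open>V\<close> without a case distinction on edges.\<close>

locale signed_weights =
  fixes V :: "'a set" and w sg :: "'a \<Rightarrow> 'a \<Rightarrow> real"
  assumes finite_V: "finite V"
    and w_nonneg: "w u v \<ge> 0" and w_sym: "w u v = w v u"
    and sg_cases: "sg u v = 1 \<or> sg u v = -1" and sg_sym: "sg u v = sg v u"
begin

text \<open>
  Sums over ordered pairs, so \<open>energy\<close> is twice the quadratic form of the Laplacian, and
  \<open>frustration\<close> of a signed indicator is twice the numerator of the bipartiteness ratio.
\<close>

definition energy :: "('a \<Rightarrow> real) \<Rightarrow> real" where
  "energy f = (\<Sum>u\<in>V. \<Sum>v\<in>V. w u v * (f u - sg u v * f v)\<^sup>2)"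

definition frustration :: "('a \<Rightarrow> real) \<Rightarrow> real" where
  "frustration f = (\<Sum>u\<in>V. \<Sum>v\<in>V. w u v * \<bar>f u - sg u v * f v\<bar>)"

lemma energy_nonneg: "energy f \<ge> 0"
  unfolding energy_def by (intro sum_nonneg mult_nonneg_nonneg w_nonneg) auto

lemma abs_sg [simp]: "\<bar>sg u v\<bar> = 1"
  using sg_cases[of u v] by auto

lemma sum_swap_w: "(\<Sum>u\<in>V. \<Sum>v\<in>V. w u v * g v u) = (\<Sum>u\<in>V. \<Sum>v\<in>V. w u v * g u v)"
  by (subst sum.swap) (simp add: w_sym)

lemma sum_degree_le:
  assumes "\<And>u. u \<in> V \<Longrightarrow> (\<Sum>v\<in>V. w u v) \<le> d"
  shows "(\<Sum>u\<in>V. \<Sum>v\<in>V. w u v * (f u)\<^sup>2) \<le> d * (\<Sum>u\<in>V. (f u)\<^sup>2)"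
proof -
  have "(\<Sum>u\<in>V. \<Sum>v\<in>V. w u v * (f u)\<^sup>2) = (\<Sum>u\<in>V. (\<Sum>v\<in>V. w u v) * (f u)\<^sup>2)"
    by (simp add: sum_distrib_right)
  also have "\<dots> \<le> (\<Sum>u\<in>V. d * (f u)\<^sup>2)"
    by (intro sum_mono mult_right_mono assms) auto
  finally show ?thesis by (simp add: sum_distrib_left)
qed

lemma cauchy_schwarz_w:
  "(\<Sum>u\<in>V. \<Sum>v\<in>V. w u v * (\<bar>f u v\<bar> * \<bar>g u v\<bar>)) \<le>
    sqrt (\<Sum>u\<in>V. \<Sum>v\<in>V. w u v * (f u v)\<^sup>2) * sqrt (\<Sum>u\<in>V. \<Sum>v\<in>V. w u v * (g u v)\<^sup>2)"
proof -
  let ?r = "\<lambda>(u, v). sqrt (w u v)"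
  let ?f = "\<lambda>(u, v). sqrt (w u v) * f u v" and ?g = "\<lambda>(u, v). sqrt (w u v) * g u v"
  have "(\<Sum>p\<in>V \<times> V. \<bar>?f p\<bar> * \<bar>?g p\<bar>) \<le> L2_set ?f (V \<times> V) * L2_set ?g (V \<times> V)"
    by (rule L2_set_mult_ineq)
  moreover have "(\<Sum>p\<in>V \<times> V. \<bar>?f p\<bar> * \<bar>?g p\<bar>) = (\<Sum>u\<in>V. \<Sum>v\<in>V. w u v * (\<bar>f u v\<bar> * \<bar>g u v\<bar>))"
    unfolding sum.cartesian_product
  proof (rule sum.cong[OF refl], clarify)
    fix u v
    have "sqrt (w u v) * sqrt (w u v) = w u v" using w_nonneg by simp
    then show "\<bar>sqrt (w u v) * f u v\<bar> * \<bar>sqrt (w u v) * g u v\<bar> = w u v * (\<bar>f u v\<bar> * \<bar>g u v\<bar>)"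
      using w_nonneg[of u v] by (simp add: abs_mult mult_ac)
  qed
  ultimately show ?thesis
    by (simp add: L2_set_def sum.cartesian_product power_mult_distrib w_nonneg split_def)
qed

definition superlevel :: "('a \<Rightarrow> real) \<Rightarrow> real \<Rightarrow> 'a \<Rightarrow> real" where
  "superlevel f t u = sgn (f u) * of_bool ((f u)\<^sup>2 > t)"

text \<open>On each pair, the frustration of a superlevel set is linear in the two threshold
  indicators. With \<open>(f u)\<^sup>2\<close> and \<open>(f v)\<^sup>2\<close> in their place the
  sum is bounded by Cauchy-Schwarz, and \<open>layer_cake\<close> turns this bound into a single
  threshold.\<close>

lemma cheeger_rounding:
  assumes deg: "\<And>u. u \<in> V \<Longrightarrow> (\<Sum>v\<in>V. w u v) \<le> d"
    and pos: "(\<Sum>u\<in>V. (f u)\<^sup>2) > 0"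
  shows "\<exists>t\<ge>0. (\<exists>u\<in>V. (f u)\<^sup>2 > t) \<and>
    frustration (superlevel f t) \<le>
      2 * sqrt (d * energy f / (\<Sum>u\<in>V. (f u)\<^sup>2)) * card {u\<in>V. (f u)\<^sup>2 > t}"
proof -
  define m where "m = (\<Sum>u\<in>V. (f u)\<^sup>2)"
  define K where "K = 2 * sqrt (d * energy f / m)"
  \<comment> \<open>If \<open>f u\<close> and \<open>sg u v * f v\<close> have the same strict sign,
    a pair contributes only when the threshold separates its ends: the end with the larger square
    counts \<open>+1\<close>, the other \<open>-1\<close>. Otherwise the indicators of the two ends
    add up. \<open>K\<close> is the density of frustration to be reached, so \<open>c\<close> should
    have a nonpositive total on the superlevel set.\<close>
  define \<alpha> where "\<alpha> u v = (if sg u v * f u * f v > 0 then sgn ((f u)\<^sup>2 - (f v)\<^sup>2) else 1)" for u v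
  define c where "c u = 2 * (\<Sum>v\<in>V. w u v * \<alpha> u v) - K" for u
  have double: "(\<Sum>u\<in>V. 2 * (\<Sum>v\<in>V. w u v * \<alpha> u v) * x u) =
      (\<Sum>u\<in>V. \<Sum>v\<in>V. w u v * (\<alpha> u v * x u + \<alpha> v u * x v))" for x
    using sum_swap_w[of "\<lambda>u v. \<alpha> u v * x u"]
    by (simp add: sum_distrib_left sum_distrib_right sum.distrib distrib_left algebra_simps)
  have "(\<Sum>u\<in>V. c u * (f u)\<^sup>2) = (\<Sum>u\<in>V. \<Sum>v\<in>V. w u v * (\<alpha> u v * (f u)\<^sup>2 + \<alpha> v u * (f v)\<^sup>2)) - K * m"
    by (simp only: c_def left_diff_distrib sum_subtractf double m_def) (simp add: sum_distrib_left)
  also have "(\<Sum>u\<in>V. \<Sum>v\<in>V. w u v * (\<alpha> u v * (f u)\<^sup>2 + \<alpha> v u * (f v)\<^sup>2)) \<le>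
     (\<Sum>u\<in>V. \<Sum>v\<in>V. w u v * (\<bar>f u - sg u v * f v\<bar> * \<bar>\<bar>f u\<bar> + \<bar>f v\<bar>\<bar>))"
  proof (intro sum_mono mult_left_mono w_nonneg)
    fix u v
    define b where "b = sg u v * f v"
    have b: "(f v)\<^sup>2 = b\<^sup>2" "\<bar>f v\<bar> = \<bar>b\<bar>" "sg u v * f u * f v = f u * b"
      using sg_cases[of u v] by (auto simp: b_def)
    have eq: "\<alpha> u v = (if f u * b > 0 then sgn ((f u)\<^sup>2 - b\<^sup>2) else 1)"
      "\<alpha> v u = (if f u * b > 0 then sgn (b\<^sup>2 - (f u)\<^sup>2) else 1)"
      unfolding \<alpha>_def using b sg_sym[of u v] by (auto simp: mult_ac)
    have "\<alpha> u v * (f u)\<^sup>2 + \<alpha> v u * (f v)\<^sup>2 \<le> \<bar>f u - b\<bar> * (\<bar>f u\<bar> + \<bar>b\<bar>)"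
    proof (cases "f u * b > 0")
      case True
      then have "\<bar>f u + b\<bar> = \<bar>f u\<bar> + \<bar>b\<bar>" by (auto simp: zero_less_mult_iff)
      then have "\<bar>f u - b\<bar> * (\<bar>f u\<bar> + \<bar>b\<bar>) = \<bar>(f u)\<^sup>2 - b\<^sup>2\<bar>"
        by (simp add: power2_eq_square square_diff_square_factored abs_mult mult.commute)
      moreover have "sgn (b\<^sup>2 - (f u)\<^sup>2) = - sgn ((f u)\<^sup>2 - b\<^sup>2)" by (simp add: sgn_if)
      ultimately show ?thesis
        unfolding eq b using True by (simp add: abs_sgn algebra_simps)
    next
      case False
      then have "\<bar>f u - b\<bar> = \<bar>f u\<bar> + \<bar>b\<bar>" by (auto simp: zero_less_mult_iff not_less mult_le_0_iff)
      then have "\<bar>f u - b\<bar> * (\<bar>f u\<bar> + \<bar>b\<bar>) = (f u)\<^sup>2 + b\<^sup>2 + 2 * (\<bar>f u\<bar> * \<bar>b\<bar>)"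
        by (simp add: power2_eq_square algebra_simps)
      then show ?thesis unfolding eq b using False by simp
    qed
    then show "\<alpha> u v * (f u)\<^sup>2 + \<alpha> v u * (f v)\<^sup>2 \<le> \<bar>f u - sg u v * f v\<bar> * \<bar>\<bar>f u\<bar> + \<bar>f v\<bar>\<bar>"
      by (simp add: b b_def)
  qed
  also have "\<dots> \<le> sqrt (energy f) * sqrt (\<Sum>u\<in>V. \<Sum>v\<in>V. w u v * (\<bar>f u\<bar> + \<bar>f v\<bar>)\<^sup>2)"
    unfolding energy_def by (rule cauchy_schwarz_w)
  also have "\<dots> \<le> sqrt (energy f) * sqrt (4 * (d * m))"
  proof (intro mult_left_mono real_sqrt_le_mono)
    have "(\<Sum>u\<in>V. \<Sum>v\<in>V. w u v * (\<bar>f u\<bar> + \<bar>f v\<bar>)\<^sup>2) \<le> (\<Sum>u\<in>V. \<Sum>v\<in>V. w u v * (2 * (f u)\<^sup>2 + 2 * (f v)\<^sup>2))"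
    proof (intro sum_mono mult_left_mono w_nonneg)
      fix u v
      have "0 \<le> (\<bar>f u\<bar> - \<bar>f v\<bar>)\<^sup>2" by simp
      then show "(\<bar>f u\<bar> + \<bar>f v\<bar>)\<^sup>2 \<le> 2 * (f u)\<^sup>2 + 2 * (f v)\<^sup>2"
        by (simp add: power2_sum power2_diff)
    qed
    also have "\<dots> = 4 * (\<Sum>u\<in>V. \<Sum>v\<in>V. w u v * (f u)\<^sup>2)"
      using sum_swap_w[of "\<lambda>u v. (f u)\<^sup>2"] by (simp add: distrib_left sum.distrib sum_distrib_left mult.left_commute[of _ 2] flip: sum_distrib_left)
    also have "\<dots> \<le> 4 * (d * m)" using sum_degree_le[OF deg] by (simp add: m_def)
    finally show "(\<Sum>u\<in>V. \<Sum>v\<in>V. w u v * (\<bar>f u\<bar> + \<bar>f v\<bar>)\<^sup>2) \<le> 4 * (d * m)" .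
  qed (simp add: energy_nonneg)
  also have "\<dots> = K * m"
  proof -
    have "sqrt (energy f) * sqrt (4 * (d * m)) = sqrt (4 * (d * energy f / m) * m\<^sup>2)"
      unfolding real_sqrt_mult[symmetric] using pos by (simp add: m_def power2_eq_square field_simps)
    then show ?thesis using pos unfolding real_sqrt_mult real_sqrt_four by (simp add: K_def m_def)
  qed
  finally have le: "(\<Sum>u\<in>V. c u * (f u)\<^sup>2) \<le> 0" by simp
  have "\<exists>u\<in>V. (f u)\<^sup>2 > 0"
  proof (rule ccontr)
    assume "\<not> ?thesis"
    then have "(\<Sum>u\<in>V. (f u)\<^sup>2) = 0" by (intro sum.neutral) auto
    then show False using pos by simp
  qed
  from layer_cake[OF finite_V _ this le] obtain t where t: "t \<ge> 0" "\<exists>u\<in>V. (f u)\<^sup>2 > t"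
      "(\<Sum>u\<in>V. c u * of_bool ((f u)\<^sup>2 > t)) \<le> 0" by auto
  have "frustration (superlevel f t) =
      (\<Sum>u\<in>V. \<Sum>v\<in>V. w u v * (\<alpha> u v * of_bool ((f u)\<^sup>2 > t) + \<alpha> v u * of_bool ((f v)\<^sup>2 > t)))"
    unfolding frustration_def
  proof (intro sum.cong refl arg_cong2[where f="(*)"])
    fix u v
    define b where "b = sg u v * f v"
    have b: "(f v)\<^sup>2 = b\<^sup>2" "sg u v * f u * f v = f u * b" "sg u v * sgn (f v) = sgn b"
      using sg_cases[of u v] by (auto simp: b_def sgn_minus)
    have eq: "\<alpha> u v = (if f u * b > 0 then sgn ((f u)\<^sup>2 - b\<^sup>2) else 1)"
      "\<alpha> v u = (if f u * b > 0 then sgn (b\<^sup>2 - (f u)\<^sup>2) else 1)"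
      unfolding \<alpha>_def using b sg_sym[of u v] by (auto simp: mult_ac)
    have sl: "sg u v * superlevel f t v = sgn b * of_bool (b\<^sup>2 > t)"
      unfolding superlevel_def mult.assoc[symmetric] b(3) b(1) ..
    show "\<bar>superlevel f t u - sg u v * superlevel f t v\<bar> =
        \<alpha> u v * of_bool ((f u)\<^sup>2 > t) + \<alpha> v u * of_bool ((f v)\<^sup>2 > t)"
    proof (cases "f u * b > 0")
      case True
      then have "sgn (f u) = sgn b" "\<bar>sgn b\<bar> = 1" by (auto simp: zero_less_mult_iff)
      then have "\<bar>superlevel f t u - sg u v * superlevel f t v\<bar> = \<bar>of_bool ((f u)\<^sup>2 > t) - of_bool (b\<^sup>2 > t)\<bar>"
        unfolding sl unfolding superlevel_def by (simp flip: right_diff_distrib add: abs_mult)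
      then show ?thesis unfolding eq b using True by (auto simp: sgn_if)
    next
      case False
      then have "f u = 0 \<or> b = 0 \<or> (f u > 0 \<and> b < 0) \<or> (f u < 0 \<and> b > 0)"
        by (auto simp: zero_less_mult_iff)
      \<comment> \<open>A zero value never exceeds the threshold because \<open>t \<ge> 0\<close>,
        so \<open>sgn\<close> is 1 or -1 wherever an indicator is nonzero.\<close>
      then show ?thesis unfolding sl eq b(1) unfolding superlevel_def using False t(1) by (auto simp: sgn_if)
    qed
  qed
  also have "\<dots> = (\<Sum>u\<in>V. (c u + K) * of_bool ((f u)\<^sup>2 > t))"
    by (simp add: double[symmetric] c_def)
  also have "\<dots> \<le> K * (\<Sum>u\<in>V. of_bool ((f u)\<^sup>2 > t))"
    using t(3) by (simp add: distrib_right sum.distrib sum_distrib_left)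
  also have "(\<Sum>u\<in>V. of_bool ((f u)\<^sup>2 > t)) = real (card {u\<in>V. (f u)\<^sup>2 > t})"
    using finite_V by (simp add: of_bool_def sum.If_cases Int_def)
  finally show ?thesis using t unfolding K_def m_def by blast
qed

end

section \<open>Symmetric grid cutoffs\<close>

text \<open>
  An odd staircase with integer plateaus: each unit interval contains a single ramp, of slope
  \<open>M\<close> and length \<open>1 / M\<close>, whose position is given by \<open>j\<close>. The ramps for the different \<open>j\<close> tile
  the line. Hence a point lies on a ramp for at most one \<open>j\<close>, and the total variation between two
  points, summed over \<open>j\<close>, is only \<open>M\<close> times their distance.
\<close>

definition stair :: "nat \<Rightarrow> nat \<Rightarrow> real \<Rightarrow> real" where
  "stair M j t = sgn t * (of_int \<lfloor>\<bar>t\<bar>\<rfloor> + max 0 (min 1 (real M * frac \<bar>t\<bar> - real j)))"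

lemma stair_minus [simp]: "stair M j (- t) = - stair M j t"
  by (simp add: stair_def sgn_minus)

lemma stair_nonneg: "t \<ge> 0 \<Longrightarrow> stair M j t \<ge> 0"
  by (auto simp: stair_def sgn_if)

lemma stair_of_nonneg:
  "t \<ge> 0 \<Longrightarrow> stair M j t = of_int \<lfloor>t\<rfloor> + max 0 (min 1 (real M * frac t - real j))"
  by (auto simp: stair_def sgn_if)

lemma stair_mono_nonneg:
  assumes "0 \<le> s" "s \<le> t"
  shows "stair M j s \<le> stair M j t"
proof (cases "\<lfloor>s\<rfloor> = \<lfloor>t\<rfloor>")
  case True
  then have "frac s \<le> frac t" using assms by (simp add: frac_def)
  then have "real M * frac s \<le> real M * frac t" by (rule mult_left_mono) simp
  then show ?thesis using assms True by (simp add: stair_of_nonneg)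
next
  case False
  then have "\<lfloor>s\<rfloor> + 1 \<le> \<lfloor>t\<rfloor>" using floor_mono[OF assms(2)] by linarith
  then have "real_of_int \<lfloor>s\<rfloor> + 1 \<le> real_of_int \<lfloor>t\<rfloor>" by linarith
  then show ?thesis using assms by (simp add: stair_of_nonneg)
qed

lemma stair_mono:
  assumes "s \<le> t"
  shows "stair M j s \<le> stair M j t"
proof -
  consider "0 \<le> s" | "s < 0" "0 \<le> t" | "t < 0" by linarith
  then show ?thesis
  proof cases
    case 2
    then show ?thesis using stair_nonneg[of "- s" M j] stair_nonneg[of t M j] by simp
  next
    case 3
    then show ?thesis using stair_mono_nonneg[of "- t" "- s" M j] assms by simp
  qed (use stair_mono_nonneg assms in auto)
qed

lemma stair_near: "\<bar>stair M j t - t\<bar> \<le> 1"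
proof -
  have nonneg: "\<bar>stair M j p - p\<bar> \<le> 1" if "p \<ge> 0" for p
    unfolding stair_of_nonneg[OF that] using floor_correct[of p] by linarith
  show ?thesis
  proof (cases "t \<ge> 0")
    case False
    then show ?thesis using nonneg[of "- t"] by simp
  qed (use nonneg in auto)
qed

lemma sum_ramp: "x \<ge> 0 \<Longrightarrow> (\<Sum>j<M. max 0 (min 1 (x - real j))) = min x (real M)"
proof (induction M)
  case (Suc M)
  then show ?case by (cases "x \<le> real M"; cases "x \<le> real M + 1") auto
qed auto

lemma sum_stair: "(\<Sum>j<M. stair M j t) = real M * t"
proof -
  have nonneg: "(\<Sum>j<M. stair M j p) = real M * p" if "p \<ge> 0" for p
  proof -
    have "real M * frac p \<le> real M * 1" by (intro mult_left_mono) (auto simp: less_imp_le frac_lt_1)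
    then have "(\<Sum>j<M. stair M j p) = real M * of_int \<lfloor>p\<rfloor> + real M * frac p"
      using that by (simp add: stair_of_nonneg sum.distrib sum_ramp)
    then show ?thesis by (simp add: frac_def algebra_simps)
  qed
  show ?thesis
  proof (cases "t \<ge> 0")
    case False
    then show ?thesis using nonneg[of "- t"] by (simp add: sum_negf)
  qed (use nonneg in auto)
qed

lemma stair_Ints:
  assumes "stair M i t \<notin> \<int>" "i \<noteq> j"
  shows "stair M j t \<in> \<int>"
proof -
  let ?y = "real M * frac \<bar>t\<bar>"
  have *: "0 < ?y - real l \<and> ?y - real l < 1" if "stair M l t \<notin> \<int>" for l
  proof (rule ccontr)
    assume "\<not> ?thesis"
    then have "max 0 (min 1 (?y - real l)) = 0 \<or> max 0 (min 1 (?y - real l)) = 1" by linarith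
    then have "stair M l t \<in> \<int>" by (auto simp: stair_def sgn_if)
    then show False using that by simp
  qed
  show ?thesis
  proof (rule ccontr)
    assume "stair M j t \<notin> \<int>"
    then have "i = j" using *[of i] *[of j] assms(1) by linarith
    then show False using assms(2) by simp
  qed
qed

text \<open>By monotonicity all \<open>M\<close> differences have the same sign, so their squares
  sum to at most the square of their sum, which \<open>sum_stair\<close> evaluates. Using the slope
  \<open>M\<close> for each \<open>j\<close> separately would cost another factor
  \<open>M\<close>.\<close>

lemma sum_stair_diff_sq_le:
  "(\<Sum>j<M. (stair M j s - stair M j t)\<^sup>2) \<le> (real M * (s - t))\<^sup>2"
proof -
  have le: "(\<Sum>j<M. (stair M j p - stair M j q)\<^sup>2) \<le> (real M * (p - q))\<^sup>2" if "q \<le> p" for p q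
  proof -
    define D where "D j = stair M j p - stair M j q" for j
    have D: "D j \<ge> 0" for j using stair_mono[OF that] by (simp add: D_def)
    have "(\<Sum>j<M. (D j)\<^sup>2) \<le> (\<Sum>j<M. D j * (\<Sum>l<M. D l))"
      unfolding power2_eq_square using D by (intro sum_mono mult_left_mono member_le_sum) auto
    also have "\<dots> = (\<Sum>j<M. D j)\<^sup>2" by (simp add: sum_distrib_right power2_eq_square)
    also have "(\<Sum>j<M. D j) = real M * (p - q)"
      by (simp add: D_def sum_subtractf sum_stair algebra_simps)
    finally show ?thesis by (simp add: D_def)
  qed
  show ?thesis
  proof (cases "t \<le> s")
    case False
    then have "(\<Sum>j<M. (stair M j t - stair M j s)\<^sup>2) \<le> (real M * (t - s))\<^sup>2" by (intro le) simp
    moreover have "(\<Sum>j<M. (stair M j t - stair M j s)\<^sup>2) = (\<Sum>j<M. (stair M j s - stair M j t)\<^sup>2)"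
      by (rule sum.cong[OF refl power2_commute])
    moreover have "(real M * (t - s))\<^sup>2 = (real M * (s - t))\<^sup>2"
      unfolding power_mult_distrib by (subst power2_commute) (rule refl)
    ultimately show ?thesis by simp
  qed (use le in auto)
qed

text \<open>
  Rounding to the nearest integer, with ties broken symmetrically so that the function is odd
  (\<open>round\<close> is not). The cutoff \<open>bump\<close> vanishes exactly at the ties.
\<close>

definition cell :: "real \<Rightarrow> int" where
  "cell x = (if x \<ge> 0 then \<lfloor>x + 1/2\<rfloor> else - \<lfloor>1/2 - x\<rfloor>)"

definition bump :: "real \<Rightarrow> real" where
  "bump x = 1 - 2 * \<bar>x - of_int (cell x)\<bar>"

lemma cell_minus [simp]: "cell (- x) = - cell x"
  by (auto simp: cell_def add.commute)

lemma bump_minus [simp]: "bump (- x) = bump x"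
  by (simp add: bump_def abs_minus_commute)

lemma cell_near: "\<bar>x - of_int (cell x)\<bar> \<le> 1/2"
proof (cases "x \<ge> 0")
  case True
  then have "cell x = \<lfloor>x + 1/2\<rfloor>" by (simp add: cell_def)
  then show ?thesis using floor_correct[of "x + 1/2"] unfolding abs_le_iff by linarith
next
  case False
  then have "cell x = - \<lfloor>1/2 - x\<rfloor>" by (simp add: cell_def)
  then show ?thesis using floor_correct[of "1/2 - x"] unfolding abs_le_iff by linarith
qed

lemma bump_nonneg: "bump x \<ge> 0" and bump_le_1: "bump x \<le> 1"
  using cell_near[of x] by (auto simp: bump_def)

lemma cell_near_eq: "cell x = cell y \<Longrightarrow> \<bar>x - y\<bar> \<le> 1"
  using cell_near[of x] cell_near[of y] by linarith

lemma bump_Ints: "x \<in> \<int> \<Longrightarrow> bump x = 1"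
proof -
  assume "x \<in> \<int>"
  then obtain n where n: "x = of_int n" by (auto elim: Ints_cases)
  then have "\<bar>of_int (n - cell x)\<bar> \<le> (1/2 :: real)" using cell_near[of x] by simp
  then have "n = cell x" by linarith
  then show ?thesis using n by (simp add: bump_def)
qed

lemma bump_lipschitz: "cell x = cell y \<Longrightarrow> \<bar>bump x - bump y\<bar> \<le> 2 * \<bar>x - y\<bar>"
  unfolding bump_def by (simp add: abs_if)

text \<open>\<open>bump x\<close> is twice the distance from \<open>x\<close> to the nearest end of
  its cell, and a point of another cell lies at or beyond an end.\<close>

lemma bump_le_diff:
  assumes "cell x \<noteq> cell y"
  shows "bump x \<le> 2 * \<bar>x - y\<bar>"
proof -
  have "real_of_int (cell x) + 1 \<le> of_int (cell y) \<or> of_int (cell y) \<le> real_of_int (cell x) - 1"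
    using assms by linarith
  moreover have "1 - 2 * \<bar>x - a\<bar> \<le> 2 * \<bar>x - y\<bar>" if "\<bar>y - b\<bar> \<le> 1/2" "a + 1 \<le> b \<or> b \<le> a - 1" for a b
    using that by (auto simp: abs_if split: if_splits)
  ultimately show ?thesis using cell_near[of y] unfolding bump_def by blast
qed

text \<open>
  Opposite points get the same class, because an edge of negative sign nearly reverses the
  direction of the spectral embedding.
\<close>

definition cutoff :: "nat \<Rightarrow> (nat \<Rightarrow> real) \<Rightarrow> real" where
  "cutoff k x = Min ((\<lambda>i. bump (x i)) ` {..<k})"

definition cell_class :: "nat \<Rightarrow> (nat \<Rightarrow> real) \<Rightarrow> (nat \<Rightarrow> int) set" where
  "cell_class k x = {\<lambda>i. if i < k then cell (x i) else 0, \<lambda>i. if i < k then - cell (x i) else 0}"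

lemma cutoff_le: "i < k \<Longrightarrow> cutoff k x \<le> bump (x i)"
  by (simp add: cutoff_def)

lemma cutoff_attained: "k > 0 \<Longrightarrow> \<exists>i<k. cutoff k x = bump (x i)"
proof -
  assume "k > 0"
  then have "cutoff k x \<in> (\<lambda>i. bump (x i)) ` {..<k}" unfolding cutoff_def by (intro Min_in) auto
  then show ?thesis by auto
qed

lemma cutoff_nonneg: "k > 0 \<Longrightarrow> cutoff k x \<ge> 0"
  using cutoff_attained[of k x] bump_nonneg by auto

lemma cutoff_le_1: "k > 0 \<Longrightarrow> cutoff k x \<le> 1"
  using cutoff_attained[of k x] bump_le_1 by auto

lemma cell_class_eqD:
  assumes "cell_class k x = cell_class k y"
  obtains \<tau> :: real where "\<tau> = 1 \<or> \<tau> = -1" "\<And>i. i < k \<Longrightarrow> cell (x i) = cell (\<tau> * y i)"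
proof -
  have "(\<lambda>i. if i < k then cell (x i) else 0) \<in> cell_class k y"
    unfolding assms[symmetric] by (simp add: cell_class_def)
  then have "(\<forall>i. (if i < k then cell (x i) else 0) = (if i < k then cell (y i) else 0)) \<or>
      (\<forall>i. (if i < k then cell (x i) else 0) = (if i < k then - cell (y i) else 0))"
    unfolding cell_class_def fun_eq_iff[symmetric] by blast
  then consider "\<And>i. i < k \<Longrightarrow> cell (x i) = cell (y i)" | "\<And>i. i < k \<Longrightarrow> cell (x i) = - cell (y i)"
    by (elim disjE) (simp_all split: if_splits)
  then show ?thesis
  proof cases
    case 1
    then show ?thesis using that[of 1] by simp
  next
    case 2
    then show ?thesis using that[of "-1"] by simp
  qed
qed

text \<open>Whatever the set \<open>T\<close>, membership changes only across a cell boundary, where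
  the cutoff vanishes, so no jump arises. If all cells agree, the cutoffs are minima of functions
  with Lipschitz constant 2; a coordinate with different cells bounds both cutoffs separately. The
  sign \<open>\<tau>\<close> is absorbed since class and cutoff are even.\<close>

lemma cutoff_diff:
  fixes \<tau> :: real
  assumes k: "k > 0" and \<tau>: "\<tau> = 1 \<or> \<tau> = -1"
  shows "\<exists>i<k. \<bar>of_bool (cell_class k x \<in> T) * cutoff k x - of_bool (cell_class k y \<in> T) * cutoff k y\<bar>
    \<le> 2 * \<bar>x i - \<tau> * y i\<bar>"
proof -
  define z where "z i = \<tau> * y i" for i
  have cy: "cutoff k y = cutoff k z" and cc: "cell_class k y = cell_class k z"
    using \<tau> by (auto simp: cutoff_def z_def cell_class_def)
  show ?thesis
  proof (cases "\<forall>i<k. cell (x i) = cell (z i)")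
    case True
    then have "(\<lambda>i. if i < k then cell (z i) else 0) = (\<lambda>i. if i < k then cell (x i) else 0)"
      "(\<lambda>i. if i < k then - cell (z i) else 0) = (\<lambda>i. if i < k then - cell (x i) else 0)"
      by (simp_all add: fun_eq_iff)
    then have "cell_class k z = cell_class k x" unfolding cell_class_def by simp
    then have eq: "cell_class k y = cell_class k x" using cc by simp
    obtain i j where i: "i < k" "cutoff k x = bump (x i)" and j: "j < k" "cutoff k z = bump (z j)"
      using cutoff_attained[OF k] by metis
    have "cutoff k x - cutoff k z \<le> \<bar>bump (x j) - bump (z j)\<bar>"
      using cutoff_le[OF j(1), of x] j by simp
    moreover have "cutoff k z - cutoff k x \<le> \<bar>bump (x i) - bump (z i)\<bar>"
      using cutoff_le[OF i(1), of z] i by simp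
    ultimately have "\<exists>l<k. \<bar>cutoff k x - cutoff k z\<bar> \<le> \<bar>bump (x l) - bump (z l)\<bar>"
      using i(1) j(1) by (cases "cutoff k x \<le> cutoff k z") auto
    then obtain l where l: "l < k" "\<bar>cutoff k x - cutoff k z\<bar> \<le> \<bar>bump (x l) - bump (z l)\<bar>" by blast
    have "\<bar>bump (x l) - bump (z l)\<bar> \<le> 2 * \<bar>x l - z l\<bar>" using True l by (intro bump_lipschitz) auto
    then show ?thesis unfolding eq cy using l by (intro exI[of _ l]) (auto simp: z_def)
  next
    case False
    then obtain i where i: "i < k" "cell (x i) \<noteq> cell (z i)" by auto
    have "cutoff k x \<le> 2 * \<bar>x i - z i\<bar>"
      using cutoff_le[OF i(1), of x] bump_le_diff[OF i(2)] by simp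
    moreover have "cutoff k z \<le> 2 * \<bar>x i - z i\<bar>"
      using cutoff_le[OF i(1), of z] bump_le_diff[OF i(2)[symmetric]] by (simp add: abs_minus_commute)
    ultimately show ?thesis
      unfolding cy using i(1) cutoff_nonneg[OF k, of x] cutoff_nonneg[OF k, of z]
      by (intro exI[of _ i]) (auto simp: z_def of_bool_def)
  qed
qed

section \<open>Averaging, grouping of masses and radial projection\<close>

text \<open>Markov's inequality for two averages at once: if every \<open>j\<close> failed,
  \<open>p j / P + q j / Q\<close> would exceed 2 everywhere although its average is at most 2. The
  case \<open>Q = 0\<close>, where all \<open>q j\<close> vanish, occurs when the energy to be
  controlled is zero.\<close>

lemma pigeonhole_two:
  fixes p q :: "nat \<Rightarrow> real"
  assumes M: "M > 0" and "\<And>j. j < M \<Longrightarrow> p j \<ge> 0" "\<And>j. j < M \<Longrightarrow> q j \<ge> 0"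
    and p: "(\<Sum>j<M. p j) \<le> P * real M" and q: "(\<Sum>j<M. q j) \<le> Q * real M" and P: "P > 0" and Q: "Q \<ge> 0"
  shows "\<exists>j<M. p j \<le> 2 * P \<and> q j \<le> 2 * Q"
proof (cases "Q = 0")
  case True
  then have "(\<Sum>j<M. q j) = 0" using assms by (intro antisym sum_nonneg) auto
  then have q0: "\<forall>j\<in>{..<M}. q j = 0" by (subst (asm) sum_nonneg_eq_0_iff) (use assms in auto)
  show ?thesis
  proof (rule ccontr)
    assume "\<not> ?thesis"
    then have "2 * P < p j" if "j < M" for j using that q0 True by force
    then have "(\<Sum>j<M. 2 * P) < (\<Sum>j<M. p j)" using M by (intro sum_strict_mono) auto
    moreover have "P * real M > 0" using P M by simp
    moreover have "(\<Sum>j<M. 2 * P) = 2 * (P * real M)" by simp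
    ultimately show False using p by linarith
  qed
next
  case False
  with Q have Q: "Q > 0" by simp
  show ?thesis
  proof (rule ccontr)
    assume *: "\<not> ?thesis"
    have "2 < p j / P + q j / Q" if j: "j < M" for j
    proof -
      have "p j / P \<ge> 0" "q j / Q \<ge> 0" using assms j Q by auto
      moreover have "2 * P < p j \<or> 2 * Q < q j" using * j by (auto simp: not_le)
      then have "p j / P > 2 \<or> q j / Q > 2" using P Q by (simp add: pos_less_divide_eq)
      ultimately show ?thesis by linarith
    qed
    then have "(\<Sum>j<M. 2) < (\<Sum>j<M. p j / P + q j / Q)" using M by (intro sum_strict_mono) auto
    also have "\<dots> = (\<Sum>j<M. p j) / P + (\<Sum>j<M. q j) / Q" by (simp add: sum.distrib sum_divide_distrib)
    also have "\<dots> \<le> real M + real M" using p q P Q by (intro add_mono) (auto simp: field_simps)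
    finally show False by simp
  qed
qed

text \<open>A group of least cardinality with mass at least \<open>a\<close> has mass at most
  \<open>b\<close>: either it is a single element, or all its elements are lighter than
  \<open>a\<close> and removing one leaves less than \<open>a\<close>, so that it weighs less than
  \<open>2 * a\<close>. Each group thus takes at most \<open>b\<close> from the total, and the
  assumed total still leaves \<open>a\<close> for the last group.\<close>

lemma greedy_grouping:
  fixes m :: "'b \<Rightarrow> real"
  assumes "finite C" "\<And>c. c \<in> C \<Longrightarrow> 0 \<le> m c" "\<And>c. c \<in> C \<Longrightarrow> m c \<le> b"
    and "2 * a \<le> b" "0 < a" "(\<Sum>c\<in>C. m c) \<ge> real k * b - b + a"
  shows "\<exists>T :: nat \<Rightarrow> 'b set. (\<forall>g<k. T g \<subseteq> C \<and> (\<Sum>c\<in>T g. m c) \<ge> a) \<and>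
    (\<forall>g<k. \<forall>h<k. g \<noteq> h \<longrightarrow> T g \<inter> T h = {})"
  using assms
proof (induction k arbitrary: C)
  case 0
  then show ?case by auto
next
  case (Suc k)
  have b: "b > 0" using Suc.prems by linarith
  have "a \<le> (\<Sum>c\<in>C. m c)" 
  proof -
    have "real k * b \<ge> 0" using b by simp
    then show ?thesis using Suc.prems(6) by (simp add: algebra_simps)
  qed
  then have "\<exists>S\<subseteq>C. (\<Sum>c\<in>S. m c) \<ge> a" by blast
  then obtain S where S: "S \<subseteq> C" "(\<Sum>c\<in>S. m c) \<ge> a"
    and min: "\<And>S'. S' \<subseteq> C \<Longrightarrow> (\<Sum>c\<in>S'. m c) \<ge> a \<Longrightarrow> card S \<le> card S'"
    using ex_has_least_nat[of "\<lambda>S. S \<subseteq> C \<and> (\<Sum>c\<in>S. m c) \<ge> a" _ card] by metis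
  have finS: "finite S" using S Suc.prems(1) finite_subset by blast
  have "S \<noteq> {}" using S(2) Suc.prems(5) by auto
  then obtain c where c: "c \<in> S" by blast
  have Sle: "(\<Sum>c\<in>S. m c) \<le> b"
  proof (cases "m c \<ge> a")
    case True
    then have "card S \<le> 1" using min[of "{c}"] c S by auto
    then have "S = {c}" using c finS by (auto simp: card_le_Suc0_iff_eq)
    then show ?thesis using Suc.prems(3)[of c] S c by auto
  next
    case False
    have "card (S - {c}) < card S" using c finS by (intro card_Diff1_less)
    then have "(\<Sum>c\<in>S - {c}. m c) < a" using min[of "S - {c}"] S by force
    then have "(\<Sum>c\<in>S. m c) < 2 * a" using False c finS by (simp add: sum.remove)
    then show ?thesis using Suc.prems(4) by simp
  qed
  have "(\<Sum>c\<in>C. m c) = (\<Sum>c\<in>C - S. m c) + (\<Sum>c\<in>S. m c)"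
    using S Suc.prems(1) by (simp add: sum.subset_diff)
  then have "(\<Sum>c\<in>C - S. m c) \<ge> real k * b - b + a"
    using Suc.prems(6) Sle by (simp add: algebra_simps)
  with Suc.IH[of "C - S"] Suc.prems obtain T where
    T: "\<forall>g<k. T g \<subseteq> C - S \<and> (\<Sum>c\<in>T g. m c) \<ge> a" "\<forall>g<k. \<forall>h<k. g \<noteq> h \<longrightarrow> T g \<inter> T h = {}"
    by auto
  show ?case
  proof (intro exI[of _ "\<lambda>g. if g = k then S else T g"] conjI allI impI)
    fix g h assume gh: "g < Suc k" "h < Suc k" "g \<noteq> h"
    show "(if g = k then S else T g) \<inter> (if h = k then S else T h) = {}"
    proof (cases "g = k \<or> h = k")
      case True
      then show ?thesis using gh T(1) by (auto simp: less_Suc_eq)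
    next
      case False
      then show ?thesis using gh T(2) by simp
    qed
  qed (use T S in \<open>auto simp: less_Suc_eq\<close>)
qed

text \<open>Scaling \<open>a i / na - b i / nb\<close> by \<open>nb\<close> gives
  \<open>(nb - na) * (a i / na) + (a i - b i)\<close>, and both parts have at most the norm of the
  difference of the two vectors; hence 4 as the square of 2. The weight involves only
  \<open>b\<close>, so \<open>a\<close> may vanish, its quotients then being 0.\<close>

lemma radial_projection:
  fixes a b :: "nat \<Rightarrow> real" and I :: "nat set"
  defines "na \<equiv> L2_set a I" and "nb \<equiv> L2_set b I"
  assumes I: "finite I"
  shows "nb\<^sup>2 * (\<Sum>i\<in>I. (a i / na - b i / nb)\<^sup>2) \<le> 4 * (\<Sum>i\<in>I. (a i - b i)\<^sup>2)"
proof (cases "nb = 0")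
  case True
  then show ?thesis by (simp add: sum_nonneg)
next
  case False
  have na: "na \<ge> 0" and nb: "nb \<ge> 0" by (simp_all add: na_def nb_def)
  have "nb \<le> na + L2_set (\<lambda>i. b i - a i) I"
    using L2_set_triangle_ineq[of a "\<lambda>i. b i - a i" I] by (simp add: na_def nb_def)
  moreover have "na \<le> nb + L2_set (\<lambda>i. a i - b i) I"
    using L2_set_triangle_ineq[of b "\<lambda>i. a i - b i" I] by (simp add: na_def nb_def)
  moreover have "L2_set (\<lambda>i. b i - a i) I = L2_set (\<lambda>i. a i - b i) I"
    by (simp add: L2_set_def power2_commute)
  ultimately have nab: "\<bar>nb - na\<bar> \<le> L2_set (\<lambda>i. a i - b i) I" by linarith
  have unit: "L2_set (\<lambda>i. (nb - na) * (a i / na)) I \<le> \<bar>nb - na\<bar>"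
  proof -
    have "L2_set (\<lambda>i. (nb - na) * (a i / na)) I = L2_set (\<lambda>i. \<bar>nb - na\<bar> / na * a i) I"
      unfolding L2_set_def by (rule arg_cong[of _ _ sqrt], rule sum.cong) (auto simp: power_mult_distrib power_divide)
    also have "\<dots> = \<bar>nb - na\<bar> / na * na"
      unfolding na_def by (rule L2_set_right_distrib[symmetric]) simp
    also have "\<dots> \<le> \<bar>nb - na\<bar>" by (cases "na = 0") auto
    finally show ?thesis .
  qed
  have a0: "na * (a i / na) = a i" if "i \<in> I" for i
    using that I by (cases "na = 0") (auto simp: na_def L2_set_eq_0_iff)
  have "L2_set (\<lambda>i. nb * (a i / na - b i / nb)) I = L2_set (\<lambda>i. (nb - na) * (a i / na) + (a i - b i)) I"
  proof (rule L2_set_cong[OF refl])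
    fix i assume "i \<in> I"
    then show "nb * (a i / na - b i / nb) = (nb - na) * (a i / na) + (a i - b i)"
      unfolding left_diff_distrib right_diff_distrib using a0 False by simp
  qed
  also have "\<dots> \<le> L2_set (\<lambda>i. (nb - na) * (a i / na)) I + L2_set (\<lambda>i. a i - b i) I"
    by (rule L2_set_triangle_ineq)
  also have "\<dots> \<le> 2 * L2_set (\<lambda>i. a i - b i) I" using unit nab by linarith
  finally have "(L2_set (\<lambda>i. nb * (a i / na - b i / nb)) I)\<^sup>2 \<le> (2 * L2_set (\<lambda>i. a i - b i) I)\<^sup>2"
    by (rule power_mono) simp
  then show ?thesis
    by (simp add: L2_set_def power_mult_distrib sum_nonneg sum_distrib_left)
qed

section \<open>Localization of the spectral embedding\<close>

context signed_weights
begin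

text \<open>Isotropy of the embedding: along any unit direction \<open>y\<close>, the embedded
  points carry total mass 1.\<close>

lemma sum_orthonormal_sq:
  fixes F :: "nat \<Rightarrow> 'a \<Rightarrow> real"
  assumes ON: "\<And>i j. i < k \<Longrightarrow> j < k \<Longrightarrow> (\<Sum>u\<in>V. F i u * F j u) = of_bool (i = j)"
  shows "(\<Sum>u\<in>V. (\<Sum>i<k. y i * F i u)\<^sup>2) = (\<Sum>i<k. (y i)\<^sup>2)"
proof -
  have "(\<Sum>u\<in>V. (\<Sum>i<k. y i * F i u)\<^sup>2) = (\<Sum>u\<in>V. \<Sum>i<k. \<Sum>j<k. y i * y j * (F i u * F j u))"
    by (simp add: power2_eq_square sum_product algebra_simps)
  also have "\<dots> = (\<Sum>i<k. \<Sum>u\<in>V. \<Sum>j<k. y i * y j * (F i u * F j u))" by (rule sum.swap)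
  also have "\<dots> = (\<Sum>i<k. \<Sum>j<k. \<Sum>u\<in>V. y i * y j * (F i u * F j u))"
    by (intro sum.cong refl sum.swap)
  also have "\<dots> = (\<Sum>i<k. \<Sum>j<k. y i * y j * of_bool (i = j))"
    by (intro sum.cong refl) (simp add: sum_distrib_left[symmetric] ON)
  also have "\<dots> = (\<Sum>i<k. (y i)\<^sup>2)"
    by (intro sum.cong refl) (simp add: power2_eq_square of_bool_def if_distrib[of "\<lambda>x. _ * x"] sum.delta cong: if_cong)
  finally show ?thesis .
qed

text \<open>
  The total mass of the embedding is \<open>k\<close>, so a region of small projective diameter carries
  barely more than one \<open>k\<close>-th of it. The quotients are \<open>0\<close> where the embedding vanishes, which
  is harmless because such vertices have no mass.
\<close>

lemma spreading:
  fixes F :: "nat \<Rightarrow> 'a \<Rightarrow> real" and k :: nat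
  defines "r \<equiv> \<lambda>u. L2_set (\<lambda>i. F i u) {..<k}"
  assumes ON: "\<And>i j. i < k \<Longrightarrow> j < k \<Longrightarrow> (\<Sum>u\<in>V. F i u * F j u) = of_bool (i = j)"
    and S: "S \<subseteq> V" and \<delta>: "\<delta> \<le> 1"
    and near: "\<And>u v. u \<in> S \<Longrightarrow> v \<in> S \<Longrightarrow> \<exists>\<tau>::real. (\<tau> = 1 \<or> \<tau> = -1) \<and>
       (\<Sum>i<k. (F i u / r u - \<tau> * (F i v / r v))\<^sup>2) \<le> \<delta>"
  shows "(1 - \<delta>) * (\<Sum>u\<in>S. (r u)\<^sup>2) \<le> 1"
proof (cases "\<forall>u\<in>S. r u = 0")
  case True
  then show ?thesis by simp
next
  case False
  then obtain v where v: "v \<in> S" "r v \<noteq> 0" by blast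
  have unit: "(\<Sum>i<k. (F i u / r u)\<^sup>2) = 1" if "r u \<noteq> 0" for u
  proof -
    have "(\<Sum>i<k. (F i u)\<^sup>2) = (r u)\<^sup>2" by (simp add: r_def L2_set_def sum_nonneg)
    then show ?thesis using that unfolding power_divide sum_divide_distrib[symmetric] by simp
  qed
  \<comment> \<open>Isotropy is tested in the direction of a single point of \<open>S\<close>. The
    other points of \<open>S\<close> with nonzero image are nearly parallel to it and project almost
    their whole mass onto it.\<close>
  define y where "y i = F i v / r v" for i
  have "(1 - \<delta>) * (r u)\<^sup>2 \<le> (\<Sum>i<k. y i * F i u)\<^sup>2" if u: "u \<in> S" for u
  proof (cases "r u = 0")
    case True
    then show ?thesis by simp
  next
    case ru: False
    define x where "x i = F i u / r u" for i
    obtain \<tau> :: real where \<tau>: "\<tau> = 1 \<or> \<tau> = -1" and d: "(\<Sum>i<k. (x i - \<tau> * y i)\<^sup>2) \<le> \<delta>"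
      using near[OF u v(1)] unfolding x_def y_def by blast
    define p where "p = (\<Sum>i<k. y i * x i)"
    have "(\<Sum>i<k. (x i - \<tau> * y i)\<^sup>2) = (\<Sum>i<k. (x i)\<^sup>2 + (y i)\<^sup>2 - 2 * \<tau> * (y i * x i))"
      using \<tau> by (intro sum.cong) (auto simp: power2_diff power2_sum algebra_simps)
    also have "\<dots> = 2 - 2 * \<tau> * p"
      using unit[OF ru] unit[OF v(2)] by (simp add: sum.distrib sum_subtractf sum_distrib_left p_def x_def y_def)
    finally have "\<tau> * p \<ge> 1 - \<delta> / 2" using d by simp
    then have "(1 - \<delta> / 2)\<^sup>2 \<le> (\<tau> * p)\<^sup>2" using \<delta> by (intro power_mono) auto
    moreover have "(\<tau> * p)\<^sup>2 = p\<^sup>2" using \<tau> by auto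
    moreover have "1 - \<delta> \<le> (1 - \<delta> / 2)\<^sup>2" by (simp add: power2_diff)
    ultimately have "1 - \<delta> \<le> p\<^sup>2" by linarith
    then have "(1 - \<delta>) * (r u)\<^sup>2 \<le> p\<^sup>2 * (r u)\<^sup>2" by (rule mult_right_mono) simp
    also have "\<dots> = (p * r u)\<^sup>2" by (simp add: power_mult_distrib)
    also have "p * r u = (\<Sum>i<k. y i * F i u)" using ru by (simp add: p_def x_def sum_distrib_right)
    finally show ?thesis .
  qed
  then have "(1 - \<delta>) * (\<Sum>u\<in>S. (r u)\<^sup>2) \<le> (\<Sum>u\<in>S. (\<Sum>i<k. y i * F i u)\<^sup>2)"
    unfolding sum_distrib_left by (intro sum_mono)
  also have "\<dots> \<le> (\<Sum>u\<in>V. (\<Sum>i<k. y i * F i u)\<^sup>2)"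
    using finite_V S by (intro sum_mono2) auto
  also have "\<dots> = (\<Sum>i<k. (y i)\<^sup>2)" by (rule sum_orthonormal_sq[OF ON])
  also have "\<dots> = 1" using unit[OF v(2)] by (simp add: y_def)
  finally show ?thesis .
qed

text \<open>Averages over the \<open>M\<close> ramp positions: a vertex is on a ramp for at most one
  of them, and the squared variations sum to at most \<open>(real M)\<^sup>2 / s\<^sup>2\<close>
  times that of \<open>X\<close>. Some position is within twice the average in both respects.
  Oddness of \<open>stair\<close> lets the signs pass through, and the weight
  \<open>(r v)\<^sup>2\<close> of one endpoint is the one that \<open>radial_projection\<close> can
  handle.\<close>

lemma select_shift:
  fixes X :: "'a \<Rightarrow> real" and r :: "'a \<Rightarrow> real" and s :: real
  assumes M: "M > 0" and s: "s > 0" and mass: "(\<Sum>u\<in>V. (r u)\<^sup>2) > 0"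
  shows "\<exists>j. (\<Sum>u\<in>V. of_bool (stair M j (X u / s) \<notin> \<int>) * (r u)\<^sup>2) \<le> 2 * ((\<Sum>u\<in>V. (r u)\<^sup>2) / M) \<and>
    (\<Sum>u\<in>V. \<Sum>v\<in>V. w u v * (r v)\<^sup>2 * (stair M j (X u / s) - sg u v * stair M j (X v / s))\<^sup>2) \<le>
      2 * (M / s\<^sup>2 * (\<Sum>u\<in>V. \<Sum>v\<in>V. w u v * (r v)\<^sup>2 * (X u - sg u v * X v)\<^sup>2))"
proof -
  let ?p = "\<lambda>j. \<Sum>u\<in>V. of_bool (stair M j (X u / s) \<notin> \<int>) * (r u)\<^sup>2"
  let ?q = "\<lambda>j. \<Sum>u\<in>V. \<Sum>v\<in>V. w u v * (r v)\<^sup>2 * (stair M j (X u / s) - sg u v * stair M j (X v / s))\<^sup>2"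
  let ?G = "\<Sum>u\<in>V. \<Sum>v\<in>V. w u v * (r v)\<^sup>2 * (X u - sg u v * X v)\<^sup>2"
  have once: "(\<Sum>j<M. of_bool (stair M j t \<notin> \<int>)) \<le> (1::real)" for t
  proof -
    have "(\<Sum>j<M. of_bool (stair M j t \<notin> \<int>)) = real (card {j\<in>{..<M}. stair M j t \<notin> \<int>})"
      by (simp add: of_bool_def sum.If_cases Int_def)
    moreover have "card {j\<in>{..<M}. stair M j t \<notin> \<int>} \<le> 1"
      using stair_Ints by (auto simp: card_le_Suc0_iff_eq)
    ultimately show ?thesis by simp
  qed
  have "(\<Sum>j<M. ?p j) = (\<Sum>u\<in>V. (\<Sum>j<M. of_bool (stair M j (X u / s) \<notin> \<int>)) * (r u)\<^sup>2)"
    by (subst sum.swap) (simp add: sum_distrib_right)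
  also have "\<dots> \<le> (\<Sum>u\<in>V. 1 * (r u)\<^sup>2)" by (intro sum_mono mult_right_mono once) auto
  finally have p: "(\<Sum>j<M. ?p j) \<le> (\<Sum>u\<in>V. (r u)\<^sup>2) / M * M" using M by simp
  have pair: "(\<Sum>j<M. (stair M j (X u / s) - sg u v * stair M j (X v / s))\<^sup>2) \<le>
      (real M)\<^sup>2 / s\<^sup>2 * (X u - sg u v * X v)\<^sup>2" for u v
  proof -
    have "sg u v * stair M j (X v / s) = stair M j (sg u v * X v / s)" for j
      using sg_cases[of u v] by auto
    moreover have "(real M * (X u / s - sg u v * X v / s))\<^sup>2 = (real M)\<^sup>2 / s\<^sup>2 * (X u - sg u v * X v)\<^sup>2"
      unfolding diff_divide_distrib[symmetric] by (simp add: power_mult_distrib power_divide)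
    ultimately show ?thesis using sum_stair_diff_sq_le[of M "X u / s" "sg u v * X v / s"] by simp
  qed
  have "(\<Sum>j<M. ?q j) = (\<Sum>u\<in>V. \<Sum>j<M. \<Sum>v\<in>V. w u v * (r v)\<^sup>2 *
      (stair M j (X u / s) - sg u v * stair M j (X v / s))\<^sup>2)" by (rule sum.swap)
  also have "\<dots> = (\<Sum>u\<in>V. \<Sum>v\<in>V. \<Sum>j<M. w u v * (r v)\<^sup>2 *
      (stair M j (X u / s) - sg u v * stair M j (X v / s))\<^sup>2)" by (intro sum.cong refl sum.swap)
  also have "\<dots> \<le> (\<Sum>u\<in>V. \<Sum>v\<in>V. w u v * (r v)\<^sup>2 * ((real M)\<^sup>2 / s\<^sup>2 * (X u - sg u v * X v)\<^sup>2))"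
    unfolding sum_distrib_left[symmetric] by (intro sum_mono mult_left_mono pair) (simp add: w_nonneg)
  also have "\<dots> = M / s\<^sup>2 * ?G * M"
    unfolding sum_distrib_left sum_distrib_right by (intro sum.cong refl) (simp add: power2_eq_square)
  finally have q: "(\<Sum>j<M. ?q j) \<le> M / s\<^sup>2 * ?G * M" .
  have "\<exists>j<M. ?p j \<le> 2 * ((\<Sum>u\<in>V. (r u)\<^sup>2) / M) \<and> ?q j \<le> 2 * (M / s\<^sup>2 * ?G)"
    by (rule pigeonhole_two[OF M _ _ p q])
      (use M s mass in \<open>auto intro!: sum_nonneg mult_nonneg_nonneg divide_nonneg_nonneg simp: w_nonneg\<close>)
  then show ?thesis by blast
qed

lemma localization:
  fixes F :: "nat \<Rightarrow> 'a \<Rightarrow> real" and l :: real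
  assumes k: "k > 0"
    and ON: "\<And>i j. i < k \<Longrightarrow> j < k \<Longrightarrow> (\<Sum>u\<in>V. F i u * F j u) = of_bool (i = j)"
    and en: "\<And>i. i < k \<Longrightarrow> energy (F i) \<le> 2 * l"
  shows "\<exists>\<psi> :: nat \<Rightarrow> 'a \<Rightarrow> real.
    (\<forall>g<k. (\<Sum>u\<in>V. (\<psi> g u)\<^sup>2) > 0 \<and> energy (\<psi> g) \<le> 600000 * real k ^ 5 * l * (\<Sum>u\<in>V. (\<psi> g u)\<^sup>2)) \<and>
    (\<forall>g<k. \<forall>h<k. g \<noteq> h \<longrightarrow> (\<forall>u. \<psi> g u = 0 \<or> \<psi> h u = 0))"
proof -
  define r where "r u = L2_set (\<lambda>i. F i u) {..<k}" for u
  define X where "X i u = F i u / r u" for i u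
  \<comment> \<open>Points of one class differ, up to sign, by at most \<open>3 * s\<close> in each
    coordinate, so their squared distance is at most
    \<open>real k * (3 * s)\<^sup>2 = 1 / (16 * real k)\<close>, the later \<open>\<delta>\<close>.
    The value of \<open>M\<close> limits the mass lost in each coordinate to
    \<open>2 * (real k / M) = 1 / (8 * real k)\<close>, which makes 1/8 in total.\<close>
  define s where "s = 1 / (12 * real k)"
  define M where "M = 16 * k\<^sup>2"
  have s: "s > 0" and M: "M > 0" using k by (auto simp: s_def M_def)
  have l: "l \<ge> 0" using en[OF k] energy_nonneg[of "F 0"] by simp
  have r2: "(r u)\<^sup>2 = (\<Sum>i<k. (F i u)\<^sup>2)" for u by (simp add: r_def L2_set_def sum_nonneg)
  have Xr: "X i u * r u = F i u" if "i < k" for i u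
    using that by (cases "r u = 0") (auto simp: X_def r_def L2_set_eq_0_iff)
  have mass: "(\<Sum>u\<in>V. (r u)\<^sup>2) = real k"
    unfolding r2 by (subst sum.swap) (simp add: power2_eq_square ON)
  define G where "G i = (\<Sum>u\<in>V. \<Sum>v\<in>V. w u v * (r v)\<^sup>2 * (X i u - sg u v * X i v)\<^sup>2)" for i
  define N where "N u v = (\<Sum>i<k. (F i u - sg u v * F i v)\<^sup>2)" for u v
  have sumN: "(\<Sum>u\<in>V. \<Sum>v\<in>V. w u v * N u v) \<le> 2 * real k * l"
  proof -
    have "(\<Sum>u\<in>V. \<Sum>v\<in>V. w u v * N u v) = (\<Sum>u\<in>V. \<Sum>i<k. \<Sum>v\<in>V. w u v * (F i u - sg u v * F i v)\<^sup>2)"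
      unfolding N_def sum_distrib_left by (intro sum.cong refl sum.swap)
    also have "\<dots> = (\<Sum>i<k. energy (F i))" unfolding energy_def by (rule sum.swap)
    also have "\<dots> \<le> (\<Sum>i<k. 2 * l)" using en by (intro sum_mono) auto
    finally show ?thesis by simp
  qed
  have sumG: "(\<Sum>i<k. G i) \<le> 8 * real k * l"
  proof -
    have "(\<Sum>i<k. G i) = (\<Sum>u\<in>V. \<Sum>i<k. \<Sum>v\<in>V. w u v * (r v)\<^sup>2 * (X i u - sg u v * X i v)\<^sup>2)"
      unfolding G_def by (rule sum.swap)
    also have "\<dots> = (\<Sum>u\<in>V. \<Sum>v\<in>V. \<Sum>i<k. w u v * (r v)\<^sup>2 * (X i u - sg u v * X i v)\<^sup>2)"
      by (intro sum.cong refl sum.swap)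
    also have "\<dots> = (\<Sum>u\<in>V. \<Sum>v\<in>V. w u v * ((r v)\<^sup>2 * (\<Sum>i<k. (X i u - sg u v * X i v)\<^sup>2)))"
      by (simp add: sum_distrib_left mult.assoc)
    also have "\<dots> \<le> (\<Sum>u\<in>V. \<Sum>v\<in>V. w u v * (4 * N u v))"
    proof (intro sum_mono mult_left_mono w_nonneg)
      fix u v
      have rv: "L2_set (\<lambda>i. sg u v * F i v) {..<k} = r v"
        unfolding r_def L2_set_def using sg_cases[of u v] by auto
      show "(r v)\<^sup>2 * (\<Sum>i<k. (X i u - sg u v * X i v)\<^sup>2) \<le> 4 * N u v"
        using radial_projection[of "{..<k}" "\<lambda>i. sg u v * F i v" "\<lambda>i. F i u"]
        unfolding rv r_def[symmetric] N_def X_def by simp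
    qed
    also have "\<dots> = 4 * (\<Sum>u\<in>V. \<Sum>v\<in>V. w u v * N u v)"
      by (simp add: sum_distrib_left mult.left_commute)
    finally show ?thesis using sumN by simp
  qed
  have "\<forall>i. \<exists>j. (\<Sum>u\<in>V. of_bool (stair M j (X i u / s) \<notin> \<int>) * (r u)\<^sup>2) \<le> 2 * (real k / M) \<and>
    (\<Sum>u\<in>V. \<Sum>v\<in>V. w u v * (r v)\<^sup>2 * (stair M j (X i u / s) - sg u v * stair M j (X i v / s))\<^sup>2) \<le>
      2 * (M / s\<^sup>2 * G i)"
    using select_shift[OF M s, of r] k unfolding mass G_def by simp
  from choice[OF this] obtain J where
    J: "\<forall>i. (\<Sum>u\<in>V. of_bool (stair M (J i) (X i u / s) \<notin> \<int>) * (r u)\<^sup>2) \<le> 2 * (real k / M) \<and>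
      (\<Sum>u\<in>V. \<Sum>v\<in>V. w u v * (r v)\<^sup>2 * (stair M (J i) (X i u / s) - sg u v * stair M (J i) (X i v / s))\<^sup>2) \<le>
      2 * (M / s\<^sup>2 * G i)" by (rule exE)
  note J = J[rule_format, THEN conjunct1] J[rule_format, THEN conjunct2]
  define x where "x u i = stair M (J i) (X i u / s)" for u i
  define good where "good = {u\<in>V. \<forall>i<k. x u i \<in> \<int>}"
  have good_mass: "(\<Sum>u\<in>good. (r u)\<^sup>2) \<ge> real k - 1/8"
  proof -
    \<comment> \<open>Union bound: a lost vertex lies on a ramp in at least one coordinate.\<close>
    have "(\<Sum>u\<in>V - good. (r u)\<^sup>2) \<le> (\<Sum>u\<in>V. (\<Sum>i<k. of_bool (x u i \<notin> \<int>)) * (r u)\<^sup>2)"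
    proof (rule sum_le_included[where i="\<lambda>u. u"])
      show "\<forall>u\<in>V - good. \<exists>v\<in>V. v = u \<and> (r u)\<^sup>2 \<le> (\<Sum>i<k. of_bool (x v i \<notin> \<int>)) * (r v)\<^sup>2"
      proof
        fix u assume "u \<in> V - good"
        then obtain i where i: "i < k" "x u i \<notin> \<int>" and u: "u \<in> V" by (auto simp: good_def)
        have "of_bool (x u i \<notin> \<int>) \<le> (\<Sum>i<k. of_bool (x u i \<notin> \<int>) :: real)"
          using i by (intro member_le_sum) auto
        then have "1 * (r u)\<^sup>2 \<le> (\<Sum>i<k. of_bool (x u i \<notin> \<int>)) * (r u)\<^sup>2"
          using i by (intro mult_right_mono) auto
        then show "\<exists>v\<in>V. v = u \<and> (r u)\<^sup>2 \<le> (\<Sum>i<k. of_bool (x v i \<notin> \<int>)) * (r v)\<^sup>2" using u by simp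
      qed
    qed (use finite_V in \<open>auto intro!: mult_nonneg_nonneg sum_nonneg\<close>)
    also have "\<dots> = (\<Sum>i<k. \<Sum>u\<in>V. of_bool (x u i \<notin> \<int>) * (r u)\<^sup>2)"
      unfolding sum_distrib_right by (rule sum.swap)
    also have "\<dots> \<le> (\<Sum>i<k. 2 * (real k / M))"
      using J(1) by (intro sum_mono) (simp add: x_def)
    also have "\<dots> = 1/8" using k by (simp add: M_def power2_eq_square)
    finally have "(\<Sum>u\<in>V - good. (r u)\<^sup>2) \<le> 1/8" .
    moreover have "(\<Sum>u\<in>V. (r u)\<^sup>2) = (\<Sum>u\<in>V - good. (r u)\<^sup>2) + (\<Sum>u\<in>good. (r u)\<^sup>2)"
      using finite_V by (intro sum.subset_diff) (auto simp: good_def)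
    ultimately show ?thesis using mass by simp
  qed
  have fin_good: "finite good" using finite_V by (simp add: good_def)
  define cls where "cls u = cell_class k (x u)" for u
  define m where "m c = (\<Sum>u\<in>{u\<in>good. cls u = c}. (r u)\<^sup>2)" for c
  have class_mass: "m c \<le> 1 + 1 / (8 * real k)" for c
  proof -
    define \<delta> where "\<delta> = 1 / (16 * real k)"
    have "(1 - \<delta>) * (\<Sum>u\<in>{u\<in>good. cls u = c}. (r u)\<^sup>2) \<le> 1"
      unfolding r_def
    proof (rule spreading[OF ON])
      show "{u\<in>good. cls u = c} \<subseteq> V" by (auto simp: good_def)
      show "\<delta> \<le> 1" using k by (simp add: \<delta>_def)
      fix u v assume "u \<in> {u\<in>good. cls u = c}" "v \<in> {u\<in>good. cls u = c}"
      then have "cell_class k (x u) = cell_class k (x v)" by (simp add: cls_def)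
      then obtain \<tau> :: real where \<tau>: "\<tau> = 1 \<or> \<tau> = -1"
        and eq: "\<And>i. i < k \<Longrightarrow> cell (x u i) = cell (\<tau> * x v i)" by (rule cell_class_eqD) blast
      have "(X i u - \<tau> * X i v)\<^sup>2 \<le> (3 * s)\<^sup>2" if "i < k" for i
      proof -
        have "\<tau> * x v i = stair M (J i) (\<tau> * X i v / s)" using \<tau> by (auto simp: x_def)
        \<comment> \<open>Sharing a cell allows distance 1, and the staircase moves each of the two
          points by at most 1.\<close>
        then have "\<bar>X i u / s - \<tau> * X i v / s\<bar> \<le> 3"
          using cell_near_eq[OF eq[OF that]] stair_near[of M "J i" "X i u / s"]
            stair_near[of M "J i" "\<tau> * X i v / s"] by (simp add: x_def)
        then have "\<bar>X i u - \<tau> * X i v\<bar> \<le> 3 * s"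
          using s by (simp add: diff_divide_distrib[symmetric] field_simps abs_divide)
        then have "\<bar>X i u - \<tau> * X i v\<bar>\<^sup>2 \<le> (3 * s)\<^sup>2" by (intro power_mono) auto
        then show ?thesis by simp
      qed
      then have "(\<Sum>i<k. (X i u - \<tau> * X i v)\<^sup>2) \<le> (\<Sum>i<k. (3 * s)\<^sup>2)" by (intro sum_mono) auto
      also have "\<dots> = \<delta>" using k by (simp add: s_def \<delta>_def power2_eq_square)
      finally show "\<exists>\<tau>::real. (\<tau> = 1 \<or> \<tau> = -1) \<and> (\<Sum>i<k. (F i u / L2_set (\<lambda>i. F i u) {..<k} -
          \<tau> * (F i v / L2_set (\<lambda>i. F i v) {..<k}))\<^sup>2) \<le> \<delta>"
        using \<tau> unfolding X_def r_def by blast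
    qed
    then have le: "(1 - \<delta>) * m c \<le> 1" by (simp add: m_def)
    have \<delta>: "0 \<le> \<delta>" "\<delta> \<le> 1/16" using k by (auto simp: \<delta>_def field_simps)
    \<comment> \<open>Inverting \<open>1 - \<delta>\<close> costs at most a factor
      \<open>1 + 2 * \<delta>\<close> because \<open>\<delta> \<le> 1/2\<close>.\<close>
    have "1 \<le> (1 - \<delta>) * (1 + 2 * \<delta>)"
      using \<delta> mult_left_mono[of \<delta> "1/2" \<delta>] by (simp add: algebra_simps)
    then have "(1 - \<delta>) * m c \<le> (1 - \<delta>) * (1 + 2 * \<delta>)" using le by linarith
    then have "m c \<le> 1 + 2 * \<delta>" using \<delta> by (subst (asm) mult_le_cancel_left_pos) auto
    then show ?thesis by (simp add: \<delta>_def)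
  qed
  \<comment> \<open>As \<open>b \<ge> 1\<close> and \<open>real k * b = real k + 1/8\<close>, the
    grouping asks for a mass of at most \<open>real k - 3/8\<close>, while \<open>good\<close>
    carries at least \<open>real k - 1/8\<close>.\<close>
  define b where "b = 1 + 1 / (8 * real k)"
  have "\<exists>T :: nat \<Rightarrow> (nat \<Rightarrow> int) set set. (\<forall>g<k. T g \<subseteq> cls ` good \<and> (\<Sum>c\<in>T g. m c) \<ge> 1/2) \<and>
    (\<forall>g<k. \<forall>h<k. g \<noteq> h \<longrightarrow> T g \<inter> T h = {})"
  proof (rule greedy_grouping)
    show "finite (cls ` good)" using fin_good by simp
    show "0 \<le> m c" for c by (simp add: m_def sum_nonneg)
    show "m c \<le> b" for c using class_mass by (simp add: b_def)
    show "2 * (1/2) \<le> b" using k by (simp add: b_def)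
    have "(\<Sum>c\<in>cls ` good. m c) = (\<Sum>u\<in>good. (r u)\<^sup>2)"
      unfolding m_def using sum.image_gen[OF fin_good, of "\<lambda>u. (r u)\<^sup>2" cls] by simp
    moreover have "real k * b = real k + 1/8" using k by (simp add: b_def field_simps)
    moreover have "b \<ge> 1" by (simp add: b_def)
    ultimately show "(\<Sum>c\<in>cls ` good. m c) \<ge> real k * b - b + 1/2" using good_mass by simp
  qed simp
  then obtain T :: "nat \<Rightarrow> (nat \<Rightarrow> int) set set" where
    T: "\<And>g. g < k \<Longrightarrow> T g \<subseteq> cls ` good" "\<And>g. g < k \<Longrightarrow> (\<Sum>c\<in>T g. m c) \<ge> 1/2"
      and disj: "\<And>g h. g < k \<Longrightarrow> h < k \<Longrightarrow> g \<noteq> h \<Longrightarrow> T g \<inter> T h = {}" by metis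
  \<comment> \<open>\<open>\<theta>\<close> does not change when a point is replaced by its
    opposite, so multiplying the embedding by it is compatible with edges of either sign.\<close>
  define \<theta> where "\<theta> g u = of_bool (cls u \<in> T g) * cutoff k (x u)" for g u
  have \<theta>_le: "(\<theta> g u)\<^sup>2 \<le> 1" for g u
    using cutoff_nonneg[OF k, of "x u"] cutoff_le_1[OF k, of "x u"]
    by (auto simp: \<theta>_def power_le_one)
  have \<theta>_good: "\<theta> g u = 1" if "u \<in> good" "cls u \<in> T g" for g u
    using that cutoff_attained[OF k, of "x u"] by (auto simp: \<theta>_def good_def bump_Ints)
  have \<theta>_diff: "(\<theta> g u - \<theta> g v)\<^sup>2 \<le> 4 * (\<Sum>i<k. (x u i - sg u v * x v i)\<^sup>2)" for g u v
  proof -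
    obtain i where i: "i < k" "\<bar>\<theta> g u - \<theta> g v\<bar> \<le> 2 * \<bar>x u i - sg u v * x v i\<bar>"
      using cutoff_diff[OF k sg_cases[of u v], of "x u" "T g" "x v"] unfolding \<theta>_def cls_def by blast
    then have "\<bar>\<theta> g u - \<theta> g v\<bar>\<^sup>2 \<le> (2 * \<bar>x u i - sg u v * x v i\<bar>)\<^sup>2" by (intro power_mono) auto
    then have "(\<theta> g u - \<theta> g v)\<^sup>2 \<le> 4 * (x u i - sg u v * x v i)\<^sup>2" by (simp add: power_mult_distrib)
    also have "\<dots> \<le> 4 * (\<Sum>i<k. (x u i - sg u v * x v i)\<^sup>2)"
      using i by (intro mult_left_mono member_le_sum) auto
    finally show ?thesis .
  qed
  define \<Psi> where "\<Psi> g i u = \<theta> g u * F i u" for g i u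
  have \<Psi>_mass: "(\<Sum>i<k. \<Sum>u\<in>V. (\<Psi> g i u)\<^sup>2) \<ge> 1/2" if g: "g < k" for g
  proof -
    have "1/2 \<le> (\<Sum>c\<in>T g. m c)" by (rule T(2)[OF g])
    also have "\<dots> = (\<Sum>c\<in>T g. \<Sum>u\<in>{u\<in>{u\<in>good. cls u \<in> T g}. cls u = c}. (r u)\<^sup>2)"
      unfolding m_def by (intro sum.cong refl) auto
    also have "\<dots> = (\<Sum>u\<in>{u\<in>good. cls u \<in> T g}. (r u)\<^sup>2)"
      using T(1)[OF g] fin_good by (intro sum.group) (auto intro: finite_subset)
    also have "\<dots> = (\<Sum>u\<in>{u\<in>good. cls u \<in> T g}. (\<theta> g u)\<^sup>2 * (r u)\<^sup>2)"
      by (intro sum.cong) (auto simp: \<theta>_good)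
    also have "\<dots> \<le> (\<Sum>u\<in>V. (\<theta> g u)\<^sup>2 * (r u)\<^sup>2)"
      using finite_V by (intro sum_mono2) (auto simp: good_def)
    also have "\<dots> = (\<Sum>i<k. \<Sum>u\<in>V. (\<Psi> g i u)\<^sup>2)"
      unfolding r2 sum_distrib_left by (subst sum.swap) (simp add: \<Psi>_def power_mult_distrib)
    finally show ?thesis .
  qed
  have \<Psi>_energy: "(\<Sum>i<k. energy (\<Psi> g i)) \<le> 300000 * real k ^ 5 * l" for g
  proof -
    have "(\<Sum>i<k. energy (\<Psi> g i)) = (\<Sum>u\<in>V. \<Sum>i<k. \<Sum>v\<in>V. w u v * (\<Psi> g i u - sg u v * \<Psi> g i v)\<^sup>2)"
      unfolding energy_def by (rule sum.swap)
    also have "\<dots> = (\<Sum>u\<in>V. \<Sum>v\<in>V. \<Sum>i<k. w u v * (\<Psi> g i u - sg u v * \<Psi> g i v)\<^sup>2)"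
      by (intro sum.cong refl sum.swap)
    also have "\<dots> \<le> (\<Sum>u\<in>V. \<Sum>v\<in>V. w u v * (2 * N u v + 8 * ((r v)\<^sup>2 * (\<Sum>i<k. (x u i - sg u v * x v i)\<^sup>2))))"
      unfolding sum_distrib_left[symmetric]
    proof (intro sum_mono mult_left_mono w_nonneg)
      fix u v
      have "(\<Sum>i<k. (\<Psi> g i u - sg u v * \<Psi> g i v)\<^sup>2) \<le>
          (\<Sum>i<k. 2 * (F i u - sg u v * F i v)\<^sup>2 + 2 * ((\<theta> g u - \<theta> g v)\<^sup>2 * (F i v)\<^sup>2))"
      proof (rule sum_mono)
        fix i
        \<comment> \<open>Product rule for differences: \<open>p\<close> is the variation of the
          embedding, damped by the cutoff, and \<open>q\<close> the variation of the cutoff,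
          weighted by the embedding at \<open>v\<close> alone.\<close>
        define p q where "p = \<theta> g u * (F i u - sg u v * F i v)" and "q = (\<theta> g u - \<theta> g v) * (sg u v * F i v)"
        have "\<Psi> g i u - sg u v * \<Psi> g i v = p + q" by (simp add: \<Psi>_def p_def q_def algebra_simps)
        moreover have "(p + q)\<^sup>2 \<le> 2 * p\<^sup>2 + 2 * q\<^sup>2"
          using zero_le_power2[of "p - q"] by (simp add: power2_diff power2_sum)
        moreover have "p\<^sup>2 \<le> 1 * (F i u - sg u v * F i v)\<^sup>2"
          unfolding p_def power_mult_distrib by (intro mult_right_mono \<theta>_le) auto
        moreover have "q\<^sup>2 = (\<theta> g u - \<theta> g v)\<^sup>2 * (F i v)\<^sup>2"
          using sg_cases[of u v] by (auto simp: q_def power_mult_distrib)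
        ultimately show "(\<Psi> g i u - sg u v * \<Psi> g i v)\<^sup>2 \<le>
            2 * (F i u - sg u v * F i v)\<^sup>2 + 2 * ((\<theta> g u - \<theta> g v)\<^sup>2 * (F i v)\<^sup>2)" by simp
      qed
      also have "\<dots> = 2 * N u v + 2 * ((\<theta> g u - \<theta> g v)\<^sup>2 * (r v)\<^sup>2)"
        by (simp add: sum.distrib N_def r2 sum_distrib_left)
      also have "\<dots> \<le> 2 * N u v + 2 * (4 * (\<Sum>i<k. (x u i - sg u v * x v i)\<^sup>2) * (r v)\<^sup>2)"
        by (intro add_left_mono mult_left_mono mult_right_mono \<theta>_diff) auto
      finally show "(\<Sum>i<k. (\<Psi> g i u - sg u v * \<Psi> g i v)\<^sup>2) \<le>
          2 * N u v + 8 * ((r v)\<^sup>2 * (\<Sum>i<k. (x u i - sg u v * x v i)\<^sup>2))"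
        by (simp add: mult_ac)
    qed
    also have "\<dots> = 2 * (\<Sum>u\<in>V. \<Sum>v\<in>V. w u v * N u v) +
        8 * (\<Sum>u\<in>V. \<Sum>v\<in>V. \<Sum>i<k. w u v * (r v)\<^sup>2 * (x u i - sg u v * x v i)\<^sup>2)"
      by (simp add: sum.distrib distrib_left sum_distrib_left mult_ac)
    also have "(\<Sum>u\<in>V. \<Sum>v\<in>V. \<Sum>i<k. w u v * (r v)\<^sup>2 * (x u i - sg u v * x v i)\<^sup>2) =
       (\<Sum>u\<in>V. \<Sum>i<k. \<Sum>v\<in>V. w u v * (r v)\<^sup>2 * (x u i - sg u v * x v i)\<^sup>2)"
      by (intro sum.cong refl sum.swap)
    also have "\<dots> = (\<Sum>i<k. \<Sum>u\<in>V. \<Sum>v\<in>V. w u v * (r v)\<^sup>2 * (x u i - sg u v * x v i)\<^sup>2)"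
      by (rule sum.swap)
    also have "\<dots> \<le> (\<Sum>i<k. 2 * (M / s\<^sup>2 * G i))"
      using J(2) by (intro sum_mono) (simp add: x_def)
    also have "\<dots> = 2 * (M / s\<^sup>2 * (\<Sum>i<k. G i))" by (simp add: sum_distrib_left)
    also have "\<dots> \<le> 2 * (M / s\<^sup>2 * (8 * real k * l))"
      by (intro mult_left_mono sumG) auto
    \<comment> \<open>Here \<open>M / s\<^sup>2\<close> is \<open>2304 * real k ^ 4\<close>; the
      fifth power of \<open>k\<close> comes from the total energy of the \<open>k\<close>
      coordinates.\<close>
    also have "\<dots> = 36864 * (real k ^ 5 * l)"
      using k by (simp add: M_def s_def power2_eq_square eval_nat_numeral)
    finally have "(\<Sum>i<k. energy (\<Psi> g i)) \<le> 4 * (real k * l) + 294912 * (real k ^ 5 * l)"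
      using sumN by simp
    moreover have "real k * l \<le> real k ^ 5 * l"
      using l k by (intro mult_right_mono self_le_power) auto
    moreover have "0 \<le> real k ^ 5 * l" using l by simp
    ultimately show ?thesis by simp
  qed
  \<comment> \<open>Some coordinate has a quotient no larger than the quotient of the sums, where
    the mass of at least 1/2 doubles 300000. A coordinate of zero mass satisfies the reverse
    inequality only weakly, so one of nonzero mass has to supply the strictness.\<close>
  have "\<exists>i<k. (\<Sum>u\<in>V. (\<Psi> g i u)\<^sup>2) > 0 \<and> energy (\<Psi> g i) \<le> 600000 * real k ^ 5 * l * (\<Sum>u\<in>V. (\<Psi> g i u)\<^sup>2)"
    if g: "g < k" for g
  proof (rule ccontr)
    let ?R = "600000 * real k ^ 5 * l" and ?m = "\<lambda>i. \<Sum>u\<in>V. (\<Psi> g i u)\<^sup>2"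
    assume neg: "\<not> ?thesis"
    have *: "?m i = 0 \<or> ?R * ?m i < energy (\<Psi> g i)" if "i < k" for i
    proof -
      have "?m i \<ge> 0" by (intro sum_nonneg) auto
      moreover have "\<not> 0 < ?m i \<or> \<not> energy (\<Psi> g i) \<le> ?R * ?m i" using neg that by blast
      ultimately show ?thesis by linarith
    qed
    have "\<exists>i<k. ?m i \<noteq> 0"
    proof (rule ccontr)
      assume "\<not> ?thesis"
      then have "(\<Sum>i<k. ?m i) = 0" by simp
      then show False using \<Psi>_mass[OF g] by simp
    qed
    then obtain i0 where "i0 < k" "?m i0 \<noteq> 0" by blast
    then have "(\<Sum>i<k. ?R * ?m i) < (\<Sum>i<k. energy (\<Psi> g i))"
      using * by (intro sum_strict_mono_ex1) (force simp: energy_nonneg less_imp_le)+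
    also have "\<dots> \<le> ?R * (1/2)" using \<Psi>_energy[of g] by (simp add: mult_ac)
    also have "\<dots> \<le> ?R * (\<Sum>i<k. ?m i)" using l by (intro mult_left_mono \<Psi>_mass g) auto
    finally show False by (simp add: sum_distrib_left)
  qed
  then obtain I where I: "\<And>g. g < k \<Longrightarrow> (\<Sum>u\<in>V. (\<Psi> g (I g) u)\<^sup>2) > 0 \<and>
      energy (\<Psi> g (I g)) \<le> 600000 * real k ^ 5 * l * (\<Sum>u\<in>V. (\<Psi> g (I g) u)\<^sup>2)" by metis
  show ?thesis
  proof (intro exI[of _ "\<lambda>g. \<Psi> g (I g)"] conjI allI impI)
    fix g h u assume "g < k" "h < k" "g \<noteq> h"
    then show "\<Psi> g (I g) u = 0 \<or> \<Psi> h (I h) u = 0"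
      using disj[of g h] by (auto simp: \<Psi>_def \<theta>_def)
  qed (use I in auto)
qed

end

section \<open>The higher-order Cheeger inequality\<close>

text \<open>A zero row added to the \<open>k - 1\<close> equations makes the matrix square; its
  transpose kills the last unit vector, so the determinant is 0.\<close>

lemma underdetermined_system:
  fixes B :: "nat \<Rightarrow> nat \<Rightarrow> real"
  assumes k: "k > 0"
  obtains a :: "nat \<Rightarrow> real" where "\<exists>i<k. a i \<noteq> 0" "\<And>j. j < k - 1 \<Longrightarrow> (\<Sum>i<k. B j i * a i) = 0"
proof -
  define M where "M = mat k k (\<lambda>(j, i). if j < k - 1 then B j i else 0)"
  have M: "M \<in> carrier_mat k k" by (simp add: M_def)
  have "M\<^sup>T *\<^sub>v unit_vec k (k - 1) = 0\<^sub>v k"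
    by (rule eq_vecI) (use k in \<open>auto simp: M_def scalar_prod_right_unit\<close>)
  moreover have "unit_vec k (k - 1) \<noteq> (0\<^sub>v k :: real vec)" using k by simp
  ultimately have "\<exists>v. v \<in> carrier_vec k \<and> v \<noteq> 0\<^sub>v k \<and> M\<^sup>T *\<^sub>v v = 0\<^sub>v k"
    using unit_vec_carrier by blast
  then have "det M\<^sup>T = 0"
    using M by (subst det_0_iff_vec_prod_zero[of _ k]) auto
  then have "det M = 0" using det_transpose[OF M] by simp
  then obtain v where v: "v \<in> carrier_vec k" "v \<noteq> 0\<^sub>v k" "M *\<^sub>v v = 0\<^sub>v k"
    using det_0_iff_vec_prod_zero[OF M] by blast
  show ?thesis
  proof (rule that[of "\<lambda>i. v $ i"])
    show "\<exists>i<k. v $ i \<noteq> 0" using v(1,2) by (metis carrier_vecD eq_vecI index_zero_vec)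
    fix j assume j: "j < k - 1"
    have "(M *\<^sub>v v) $ j = (\<Sum>i<k. B j i * v $ i)"
      using j v(1) by (simp add: M_def scalar_prod_def atLeast0LessThan)
    then show "(\<Sum>i<k. B j i * v $ i) = 0" using v(3) j by simp
  qed
qed

lemma weighted_cauchy_schwarz:
  fixes a D :: "nat \<Rightarrow> real"
  shows "(\<Sum>i<k. a i * D i)\<^sup>2 \<le> (\<Sum>i<k. \<bar>D i\<bar>) * (\<Sum>i<k. (a i)\<^sup>2 * \<bar>D i\<bar>)"
proof -
  let ?p = "\<lambda>i. sqrt \<bar>D i\<bar>" and ?q = "\<lambda>i. a i * sqrt \<bar>D i\<bar>"
  have "\<bar>\<Sum>i<k. a i * D i\<bar> \<le> (\<Sum>i<k. \<bar>a i * D i\<bar>)" by (rule sum_abs)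
  also have "\<dots> = (\<Sum>i<k. \<bar>?p i\<bar> * \<bar>?q i\<bar>)" by (intro sum.cong) (auto simp: abs_mult)
  also have "\<dots> \<le> L2_set ?p {..<k} * L2_set ?q {..<k}" by (rule L2_set_mult_ineq)
  finally have "\<bar>\<Sum>i<k. a i * D i\<bar>\<^sup>2 \<le> (L2_set ?p {..<k} * L2_set ?q {..<k})\<^sup>2" by (intro power_mono) auto
  then show ?thesis by (simp add: L2_set_def power_mult_distrib sum_nonneg)
qed

context signed_weights
begin

lemma frustration_cong: "(\<And>u. u \<in> V \<Longrightarrow> f u = g u) \<Longrightarrow> frustration f = frustration g"
  unfolding frustration_def by (intro sum.cong) auto

text \<open>At each end of a pair the values have total modulus at most 1, so the differences have
  total modulus at most 2. Cauchy-Schwarz with these moduli as weights replaces the square by a sum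
  that is linear in them, at the cost of the factor 2 that becomes the 1/2 in the lower
  bound.\<close>

lemma energy_disjoint_le:
  fixes \<chi> :: "nat \<Rightarrow> 'a \<Rightarrow> real"
  assumes "\<And>u. u \<in> V \<Longrightarrow> (\<Sum>i<k. \<bar>\<chi> i u\<bar>) \<le> 1"
  shows "energy (\<lambda>u. \<Sum>i<k. a i * \<chi> i u) \<le> 2 * (\<Sum>i<k. (a i)\<^sup>2 * frustration (\<chi> i))"
proof -
  let ?D = "\<lambda>u v i. \<chi> i u - sg u v * \<chi> i v"
  have "energy (\<lambda>u. \<Sum>i<k. a i * \<chi> i u) \<le> (\<Sum>u\<in>V. \<Sum>v\<in>V. w u v * (2 * (\<Sum>i<k. (a i)\<^sup>2 * \<bar>?D u v i\<bar>)))"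
    unfolding energy_def
  proof (intro sum_mono mult_left_mono w_nonneg)
    fix u v assume uv: "u \<in> V" "v \<in> V"
    have "(\<Sum>i<k. a i * \<chi> i u) - sg u v * (\<Sum>i<k. a i * \<chi> i v) = (\<Sum>i<k. a i * ?D u v i)"
      by (simp add: sum_distrib_left sum_subtractf[symmetric] algebra_simps)
    moreover have "(\<Sum>i<k. \<bar>?D u v i\<bar>) \<le> (\<Sum>i<k. \<bar>\<chi> i u\<bar> + \<bar>\<chi> i v\<bar>)"
    proof (rule sum_mono)
      fix i
      have "\<bar>?D u v i\<bar> \<le> \<bar>\<chi> i u\<bar> + \<bar>sg u v * \<chi> i v\<bar>" by (rule abs_triangle_ineq4)
      then show "\<bar>?D u v i\<bar> \<le> \<bar>\<chi> i u\<bar> + \<bar>\<chi> i v\<bar>" by (simp add: abs_mult)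
    qed
    moreover have "(\<Sum>i<k. \<bar>\<chi> i u\<bar> + \<bar>\<chi> i v\<bar>) \<le> 2"
      using assms[OF uv(1)] assms[OF uv(2)] by (simp add: sum.distrib)
    ultimately show "((\<Sum>i<k. a i * \<chi> i u) - sg u v * (\<Sum>i<k. a i * \<chi> i v))\<^sup>2 \<le>
        2 * (\<Sum>i<k. (a i)\<^sup>2 * \<bar>?D u v i\<bar>)"
      using weighted_cauchy_schwarz[of a "?D u v" k]
        mult_right_mono[of "\<Sum>i<k. \<bar>?D u v i\<bar>" 2 "\<Sum>i<k. (a i)\<^sup>2 * \<bar>?D u v i\<bar>"]
      by (simp add: sum_nonneg)
  qed
  also have "\<dots> = 2 * (\<Sum>u\<in>V. \<Sum>v\<in>V. \<Sum>i<k. (a i)\<^sup>2 * (w u v * \<bar>?D u v i\<bar>))"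
    by (simp add: sum_distrib_left mult_ac)
  also have "(\<Sum>u\<in>V. \<Sum>v\<in>V. \<Sum>i<k. (a i)\<^sup>2 * (w u v * \<bar>?D u v i\<bar>)) =
      (\<Sum>u\<in>V. \<Sum>i<k. \<Sum>v\<in>V. (a i)\<^sup>2 * (w u v * \<bar>?D u v i\<bar>))" by (intro sum.cong refl sum.swap)
  also have "\<dots> = (\<Sum>i<k. \<Sum>u\<in>V. \<Sum>v\<in>V. (a i)\<^sup>2 * (w u v * \<bar>?D u v i\<bar>))" by (rule sum.swap)
  also have "\<dots> = (\<Sum>i<k. (a i)\<^sup>2 * frustration (\<chi> i))" by (simp add: frustration_def sum_distrib_left)
  finally show ?thesis .
qed

end

section \<open>From the graph to abstract signed weights\<close>

text \<open>The default 1 off the edges provides the sign that \<open>signed_weights\<close> demands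
  for every pair; in a signed graph such pairs have weight 0.\<close>

definition edge_sign :: "wsgraph \<Rightarrow> nat \<Rightarrow> nat \<Rightarrow> real" where
  "edge_sign \<Gamma> u v = (if {u, v} \<in> edges \<Gamma> then real_of_int (signature \<Gamma> {u, v}) else 1)"

definition signed_indicator :: "nat set \<Rightarrow> nat set \<Rightarrow> nat \<Rightarrow> real" where
  "signed_indicator A B u = of_bool (u \<in> A) - of_bool (u \<in> B)"

context
  fixes \<Gamma> :: wsgraph
  assumes graph: "signed_graph \<Gamma>"
begin

lemma weight_nonneg: "weight \<Gamma> u v \<ge> 0"
proof (cases "{u, v} \<in> edges \<Gamma>")
  case True
  then have "weight \<Gamma> u v > 0" using graph unfolding signed_graph_def by blast
  then show ?thesis by simp
next
  case False
  then have "weight \<Gamma> u v = 0" using graph unfolding signed_graph_def by blast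
  then show ?thesis by simp
qed

lemma weight_sym: "weight \<Gamma> u v = weight \<Gamma> v u"
  using graph unfolding signed_graph_def by blast

lemma weight_nonedge: "{u, v} \<notin> edges \<Gamma> \<Longrightarrow> weight \<Gamma> u v = 0"
  using graph unfolding signed_graph_def by blast

lemma signature_cases: "{u, v} \<in> edges \<Gamma> \<Longrightarrow> signature \<Gamma> {u, v} = 1 \<or> signature \<Gamma> {u, v} = -1"
  using graph unfolding signed_graph_def by blast

interpretation signed_weights "verts \<Gamma>" "weight \<Gamma>" "edge_sign \<Gamma>"
proof
  fix u v
  show "edge_sign \<Gamma> u v = 1 \<or> edge_sign \<Gamma> u v = -1"
    using signature_cases[of u v] by (auto simp: edge_sign_def)
  show "edge_sign \<Gamma> u v = edge_sign \<Gamma> v u" by (simp add: edge_sign_def insert_commute)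
qed (simp_all add: weight_nonneg weight_sym)

lemma edge_weight_conv:
  assumes "A \<subseteq> verts \<Gamma>" "B \<subseteq> verts \<Gamma>"
  shows "edge_weight \<Gamma> A B = (\<Sum>u<nverts \<Gamma>. \<Sum>v<nverts \<Gamma>. weight \<Gamma> u v * of_bool (u \<in> A \<and> v \<in> B))"
proof -
  have "edge_weight \<Gamma> A B = (\<Sum>u\<in>A. \<Sum>v<nverts \<Gamma>. weight \<Gamma> u v * of_bool (u \<in> A \<and> v \<in> B))"
    unfolding edge_weight_def using assms
    by (intro sum.cong refl sum.mono_neutral_cong_left) auto
  also have "\<dots> = (\<Sum>u<nverts \<Gamma>. \<Sum>v<nverts \<Gamma>. weight \<Gamma> u v * of_bool (u \<in> A \<and> v \<in> B))"
    using assms by (intro sum.mono_neutral_left) auto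
  finally show ?thesis .
qed

lemma signed_edge_weight_conv:
  assumes "A \<subseteq> verts \<Gamma>" "B \<subseteq> verts \<Gamma>"
  shows "signed_edge_weight \<Gamma> s A B =
    (\<Sum>u<nverts \<Gamma>. \<Sum>v<nverts \<Gamma>. weight \<Gamma> u v * of_bool (u \<in> A \<and> v \<in> B \<and> edge_sign \<Gamma> u v = s))"
proof -
  have "signed_edge_weight \<Gamma> s A B =
    (\<Sum>u\<in>A. \<Sum>v<nverts \<Gamma>. weight \<Gamma> u v * of_bool (u \<in> A \<and> v \<in> B \<and> edge_sign \<Gamma> u v = s))"
    unfolding signed_edge_weight_def using assms
    by (intro sum.cong refl sum.mono_neutral_cong_left)
      (auto simp: edge_sign_def weight_nonedge split: if_splits)
  also have "\<dots> = (\<Sum>u<nverts \<Gamma>. \<Sum>v<nverts \<Gamma>. weight \<Gamma> u v * of_bool (u \<in> A \<and> v \<in> B \<and> edge_sign \<Gamma> u v = s))"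
    using assms by (intro sum.mono_neutral_left) auto
  finally show ?thesis .
qed

text \<open>Adding the numerator to its transpose makes it agree with the frustration pair by pair:
  2 for a positive edge between \<open>A\<close> and \<open>B\<close> or a negative edge inside
  either, 1 for an edge leaving the union. This doubling is the 2 in the denominator.\<close>

lemma bipartiteness_ratio_conv:
  assumes AB: "A \<subseteq> verts \<Gamma>" "B \<subseteq> verts \<Gamma>" "A \<inter> B = {}"
  shows "bipartiteness_ratio \<Gamma> (\<lambda>_. 1) A B = frustration (signed_indicator A B) / (2 * card (A \<union> B))"
proof -
  let ?n = "nverts \<Gamma>" and ?w = "weight \<Gamma>"
  let ?i = "\<lambda>u v. 2 * of_bool (u \<in> A \<and> v \<in> B \<and> edge_sign \<Gamma> u v = 1)
      + of_bool (u \<in> A \<and> v \<in> A \<and> edge_sign \<Gamma> u v = -1)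
      + of_bool (u \<in> B \<and> v \<in> B \<and> edge_sign \<Gamma> u v = -1)
      + of_bool (u \<in> A \<union> B \<and> v \<in> verts \<Gamma> - (A \<union> B)) :: real"
  define num where "num = 2 * signed_edge_weight \<Gamma> 1 A B + signed_edge_weight \<Gamma> (-1) A A
        + signed_edge_weight \<Gamma> (-1) B B
        + edge_weight \<Gamma> (A \<union> B) (verts \<Gamma> - (A \<union> B))"
  have conv:
    "signed_edge_weight \<Gamma> 1 A B = (\<Sum>u<?n. \<Sum>v<?n. ?w u v * of_bool (u \<in> A \<and> v \<in> B \<and> edge_sign \<Gamma> u v = 1))"
    "signed_edge_weight \<Gamma> (-1) A A = (\<Sum>u<?n. \<Sum>v<?n. ?w u v * of_bool (u \<in> A \<and> v \<in> A \<and> edge_sign \<Gamma> u v = -1))"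
    "signed_edge_weight \<Gamma> (-1) B B = (\<Sum>u<?n. \<Sum>v<?n. ?w u v * of_bool (u \<in> B \<and> v \<in> B \<and> edge_sign \<Gamma> u v = -1))"
    "edge_weight \<Gamma> (A \<union> B) (verts \<Gamma> - (A \<union> B)) =
      (\<Sum>u<?n. \<Sum>v<?n. ?w u v * of_bool (u \<in> A \<union> B \<and> v \<in> verts \<Gamma> - (A \<union> B)))"
    using AB signed_edge_weight_conv[OF AB(1,2), of 1] signed_edge_weight_conv[OF AB(1,1), of "-1"]
      signed_edge_weight_conv[OF AB(2,2), of "-1"] edge_weight_conv[of "A \<union> B" "verts \<Gamma> - (A \<union> B)"]
    by (simp_all only: of_int_1 of_int_minus Un_least Diff_subset)
  have num: "num = (\<Sum>u<?n. \<Sum>v<?n. ?w u v * ?i u v)"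
    unfolding num_def
    by (simp only: conv distrib_left sum.distrib sum_distrib_left mult.left_commute[of 2])
  have "2 * num = (\<Sum>u<?n. \<Sum>v<?n. ?w u v * ?i u v) + (\<Sum>u<?n. \<Sum>v<?n. ?w u v * ?i v u)"
    unfolding sum_swap_w[of ?i] num by (rule mult_2)
  also have "\<dots> = (\<Sum>u<?n. \<Sum>v<?n. ?w u v * (?i u v + ?i v u))"
    by (simp only: distrib_left sum.distrib)
  also have "\<dots> = frustration (signed_indicator A B)"
    unfolding frustration_def
  proof (intro sum.cong refl arg_cong2[where f="(*)"])
    fix u v assume "u \<in> verts \<Gamma>" "v \<in> verts \<Gamma>"
    then show "?i u v + ?i v u = \<bar>signed_indicator A B u - edge_sign \<Gamma> u v * signed_indicator A B v\<bar>"
      using AB(3) sg_cases[of u v] sg_sym[of u v]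
      by (cases "u \<in> A"; cases "u \<in> B"; cases "v \<in> A"; cases "v \<in> B") (auto simp: signed_indicator_def)
  qed
  finally have half: "num = frustration (signed_indicator A B) / 2" by simp
  have "bipartiteness_ratio \<Gamma> (\<lambda>_. 1) A B = num / card (A \<union> B)"
    by (simp add: bipartiteness_ratio_def num_def vol_def)
  then show ?thesis unfolding half by simp
qed

lemma signed_laplacian_carrier: "signed_laplacian \<Gamma> \<in> carrier_mat (nverts \<Gamma>) (nverts \<Gamma>)"
  unfolding signed_laplacian_def by (rule minus_carrier_mat) (simp add: signed_adjacency_def)

lemma signed_laplacian_entry:
  assumes "u < nverts \<Gamma>" "v < nverts \<Gamma>"
  shows "signed_laplacian \<Gamma> $$ (u, v) =
    of_bool (u = v) * (\<Sum>v<nverts \<Gamma>. weight \<Gamma> u v) - edge_sign \<Gamma> u v * weight \<Gamma> u v"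
  using assms by (auto simp: signed_laplacian_def degree_mat_def signed_adjacency_def deg_def
      edge_sign_def weight_nonedge)

lemma signed_laplacian_symmetric: "(signed_laplacian \<Gamma>)\<^sup>T = signed_laplacian \<Gamma>"
proof (rule eq_matI)
  fix i j assume "i < dim_row (signed_laplacian \<Gamma>)" "j < dim_col (signed_laplacian \<Gamma>)"
  then show "(signed_laplacian \<Gamma>)\<^sup>T $$ (i, j) = signed_laplacian \<Gamma> $$ (i, j)"
    using signed_laplacian_carrier sg_sym[of i j] weight_sym[of i j] by (auto simp: signed_laplacian_entry)
qed (use signed_laplacian_carrier in auto)

lemma energy_eq_quadratic_form:
  "energy f = 2 * (\<Sum>u<nverts \<Gamma>. \<Sum>v<nverts \<Gamma>. f u * f v * signed_laplacian \<Gamma> $$ (u, v))"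
proof -
  let ?n = "nverts \<Gamma>" and ?w = "weight \<Gamma>" and ?s = "edge_sign \<Gamma>"
  have "(\<Sum>u<?n. \<Sum>v<?n. f u * f v * signed_laplacian \<Gamma> $$ (u, v)) =
      (\<Sum>u<?n. \<Sum>v<?n. of_bool (u = v) * (f u * f v * (\<Sum>v<?n. ?w u v))) - (\<Sum>u<?n. \<Sum>v<?n. ?w u v * (?s u v * f u * f v))"
    unfolding sum_subtractf[symmetric]
    by (intro sum.cong refl) (simp add: signed_laplacian_entry algebra_simps)
  also have "(\<Sum>u<?n. \<Sum>v<?n. of_bool (u = v) * (f u * f v * (\<Sum>v<?n. ?w u v))) = (\<Sum>u<?n. \<Sum>v<?n. ?w u v * (f u)\<^sup>2)"
  proof (rule sum.cong[OF refl])
    fix u assume u: "u \<in> {..<?n}"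
    have *: "(\<Sum>v<?n. of_bool (u = v) * g v) = g u" for g :: "nat \<Rightarrow> real"
      using u by (simp add: of_bool_def if_distrib[of "\<lambda>x. x * _"] sum.delta' cong: if_cong)
    show "(\<Sum>v<?n. of_bool (u = v) * (f u * f v * (\<Sum>v<?n. ?w u v))) = (\<Sum>v<?n. ?w u v * (f u)\<^sup>2)"
      by (subst *) (simp add: sum_distrib_left power2_eq_square mult_ac)
  qed
  finally have "2 * (\<Sum>u<?n. \<Sum>v<?n. f u * f v * signed_laplacian \<Gamma> $$ (u, v)) =
      (\<Sum>u<?n. \<Sum>v<?n. ?w u v * (f u)\<^sup>2) + (\<Sum>u<?n. \<Sum>v<?n. ?w u v * (f v)\<^sup>2) - (\<Sum>u<?n. \<Sum>v<?n. ?w u v * (2 * ?s u v * f u * f v))"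
    using sum_swap_w[of "\<lambda>u v. (f u)\<^sup>2"] by (simp add: sum_distrib_left mult_ac)
  also have "\<dots> = energy f"
    unfolding energy_def sum.distrib[symmetric] sum_subtractf[symmetric]
  proof (intro sum.cong refl)
    fix u v
    have "(?s u v * f v)\<^sup>2 = (f v)\<^sup>2" using sg_cases[of u v] by auto
    then show "?w u v * (f u)\<^sup>2 + ?w u v * (f v)\<^sup>2 - ?w u v * (2 * ?s u v * f u * f v) = ?w u v * (f u - ?s u v * f v)\<^sup>2"
      by (simp add: power2_diff algebra_simps)
  qed
  finally show ?thesis by simp
qed

lemma laplacian_spectral:
  obtains e :: "nat \<Rightarrow> nat \<Rightarrow> real" where
    "\<And>i j. i < nverts \<Gamma> \<Longrightarrow> j < nverts \<Gamma> \<Longrightarrow> (\<Sum>u<nverts \<Gamma>. e i u * e j u) = of_bool (i = j)"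
    "\<And>f. (\<Sum>i<nverts \<Gamma>. (\<Sum>u<nverts \<Gamma>. e i u * f u)\<^sup>2) = (\<Sum>u<nverts \<Gamma>. (f u)\<^sup>2)"
    "\<And>f. energy f = 2 * (\<Sum>i<nverts \<Gamma>. nth_eigenvalue (Suc i) (signed_laplacian \<Gamma>) * (\<Sum>u<nverts \<Gamma>. e i u * f u)\<^sup>2)"
    "\<And>i j. i \<le> j \<Longrightarrow> j < nverts \<Gamma> \<Longrightarrow>
      nth_eigenvalue (Suc i) (signed_laplacian \<Gamma>) \<le> nth_eigenvalue (Suc j) (signed_laplacian \<Gamma>)"
proof -
  let ?n = "nverts \<Gamma>" and ?l = "\<lambda>i. nth_eigenvalue (Suc i) (signed_laplacian \<Gamma>)"
  obtain e :: "nat \<Rightarrow> nat \<Rightarrow> real" where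
    e: "\<And>i j. i < ?n \<Longrightarrow> j < ?n \<Longrightarrow> (\<Sum>u<?n. e i u * e j u) = of_bool (i = j)"
    "\<And>u v. u < ?n \<Longrightarrow> v < ?n \<Longrightarrow> (\<Sum>i<?n. e i u * e i v) = of_bool (u = v)"
    "\<And>u v. u < ?n \<Longrightarrow> v < ?n \<Longrightarrow> signed_laplacian \<Gamma> $$ (u, v) = (\<Sum>i<?n. ?l i * (e i u * e i v))"
    "\<And>i j. i \<le> j \<Longrightarrow> j < ?n \<Longrightarrow> ?l i \<le> ?l j"
    by (rule symmetric_spectral[OF signed_laplacian_carrier signed_laplacian_symmetric]) blast
  have expand: "(\<Sum>i<?n. c i * (\<Sum>u<?n. e i u * f u)\<^sup>2) =
      (\<Sum>u<?n. \<Sum>v<?n. f u * f v * (\<Sum>i<?n. c i * (e i u * e i v)))" for c f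
  proof -
    have "(\<Sum>i<?n. c i * (\<Sum>u<?n. e i u * f u)\<^sup>2) =
      (\<Sum>i<?n. \<Sum>u<?n. \<Sum>v<?n. f u * f v * (c i * (e i u * e i v)))"
      by (simp add: power2_eq_square sum_product sum_distrib_left mult_ac)
    also have "\<dots> = (\<Sum>u<?n. \<Sum>i<?n. \<Sum>v<?n. f u * f v * (c i * (e i u * e i v)))" by (rule sum.swap)
    also have "\<dots> = (\<Sum>u<?n. \<Sum>v<?n. \<Sum>i<?n. f u * f v * (c i * (e i u * e i v)))"
      by (intro sum.cong refl sum.swap)
    finally show ?thesis by (simp add: sum_distrib_left)
  qed
  show ?thesis
  proof (rule that[of e])
    fix f :: "nat \<Rightarrow> real"
    have "(\<Sum>i<?n. (\<Sum>u<?n. e i u * f u)\<^sup>2) = (\<Sum>u<?n. \<Sum>v<?n. f u * f v * of_bool (u = v))"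
      using expand[of "\<lambda>_. 1" f] by (simp add: e(2))
    also have "\<dots> = (\<Sum>u<?n. (f u)\<^sup>2)"
      by (intro sum.cong refl)
        (simp add: of_bool_def if_distrib[of "\<lambda>x. _ * x"] sum.delta' power2_eq_square cong: if_cong)
    finally show "(\<Sum>i<?n. (\<Sum>u<?n. e i u * f u)\<^sup>2) = (\<Sum>u<?n. (f u)\<^sup>2)" .
    show "energy f = 2 * (\<Sum>i<?n. ?l i * (\<Sum>u<?n. e i u * f u)\<^sup>2)"
      unfolding energy_eq_quadratic_form expand by (simp add: e(3))
  qed (use e in auto)
qed

section \<open>The two bounds on the Cheeger constant\<close>

lemma cheeger_values_finite:
  assumes "k > 0"
  shows "finite {Max ((\<lambda>i. bipartiteness_ratio \<Gamma> \<mu> (V (2 * i - 1)) (V (2 * i))) ` {1..k}) | V.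
            sub_bipartition_family \<Gamma> k V}"
proof (rule finite_subset)
  show "finite ((\<lambda>(A, B). bipartiteness_ratio \<Gamma> \<mu> A B) ` (Pow (verts \<Gamma>) \<times> Pow (verts \<Gamma>)))" by simp
  show "{Max ((\<lambda>i. bipartiteness_ratio \<Gamma> \<mu> (V (2 * i - 1)) (V (2 * i))) ` {1..k}) | V.
            sub_bipartition_family \<Gamma> k V} \<subseteq>
      (\<lambda>(A, B). bipartiteness_ratio \<Gamma> \<mu> A B) ` (Pow (verts \<Gamma>) \<times> Pow (verts \<Gamma>))"
  proof clarify
    fix V assume V: "sub_bipartition_family \<Gamma> k V"
    have "Max ((\<lambda>i. bipartiteness_ratio \<Gamma> \<mu> (V (2 * i - 1)) (V (2 * i))) ` {1..k}) \<in>
        (\<lambda>i. bipartiteness_ratio \<Gamma> \<mu> (V (2 * i - 1)) (V (2 * i))) ` {1..k}"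
      using assms by (intro Max_in) auto
    then obtain i where i: "i \<in> {1..k}" and
      eq: "Max ((\<lambda>i. bipartiteness_ratio \<Gamma> \<mu> (V (2 * i - 1)) (V (2 * i))) ` {1..k}) =
        bipartiteness_ratio \<Gamma> \<mu> (V (2 * i - 1)) (V (2 * i))" by auto
    have "V (2 * i - 1) \<subseteq> verts \<Gamma>" "V (2 * i) \<subseteq> verts \<Gamma>"
      using V i unfolding sub_bipartition_family_def sub_bipartition_def by blast+
    then show "Max ((\<lambda>i. bipartiteness_ratio \<Gamma> \<mu> (V (2 * i - 1)) (V (2 * i))) ` {1..k}) \<in>
        (\<lambda>(A, B). bipartiteness_ratio \<Gamma> \<mu> A B) ` (Pow (verts \<Gamma>) \<times> Pow (verts \<Gamma>))"
      unfolding eq by (intro image_eqI[of _ _ "(V (2 * i - 1), V (2 * i))"]) auto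
  qed
qed

lemma family_exists:
  assumes "k \<le> nverts \<Gamma>"
  shows "\<exists>V. sub_bipartition_family \<Gamma> k V"
proof
  have "2 * i - Suc 0 = Suc (2 * (i - 1))" if "i > 0" for i using that by simp
  \<comment> \<open>Position \<open>2 * i - 1\<close> receives the singleton of the vertex
    \<open>i - 1\<close> and position \<open>2 * i\<close> the empty set.\<close>
  then show "sub_bipartition_family \<Gamma> k (\<lambda>m. if odd m then {m div 2} else {})"
    using assms by (auto simp: sub_bipartition_family_def sub_bipartition_def)
qed

text \<open>One half of the Courant-Fischer principle: some nontrivial combination of the
  \<open>k\<close> signed indicators is orthogonal to the first \<open>k - 1\<close> eigenvectors,
  and there the Rayleigh quotient is at least the \<open>k\<close>-th eigenvalue.\<close>

lemma eigenvalue_le_ratio: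
  assumes k: "1 \<le> k" "k \<le> nverts \<Gamma>" and V: "sub_bipartition_family \<Gamma> k V"
    and h: "\<And>i. i \<in> {1..k} \<Longrightarrow> bipartiteness_ratio \<Gamma> (\<lambda>_. 1) (V (2 * i - 1)) (V (2 * i)) \<le> h"
  shows "nth_eigenvalue k (signed_laplacian \<Gamma>) \<le> 2 * h"
proof -
  let ?n = "nverts \<Gamma>" and ?l = "\<lambda>i. nth_eigenvalue (Suc i) (signed_laplacian \<Gamma>)"
  obtain e :: "nat \<Rightarrow> nat \<Rightarrow> real" where
    parseval: "\<And>f. (\<Sum>i<?n. (\<Sum>u<?n. e i u * f u)\<^sup>2) = (\<Sum>u<?n. (f u)\<^sup>2)" and
    en: "\<And>f. energy f = 2 * (\<Sum>i<?n. ?l i * (\<Sum>u<?n. e i u * f u)\<^sup>2)" and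
    mono: "\<And>i j. i \<le> j \<Longrightarrow> j < ?n \<Longrightarrow> ?l i \<le> ?l j"
    by (rule laplacian_spectral) blast
  define A where "A i = V (2 * i + 1)" for i
  define B where "B i = V (2 * i + 2)" for i
  define \<chi> where "\<chi> i = signed_indicator (A i) (B i)" for i
  have conv: "V (2 * Suc i - 1) = A i" "V (2 * Suc i) = B i" for i by (simp_all add: A_def B_def)
  have sub: "A i \<subseteq> verts \<Gamma>" "B i \<subseteq> verts \<Gamma>" "A i \<inter> B i = {}" "A i \<union> B i \<noteq> {}" if "i < k" for i
    using V that unfolding sub_bipartition_family_def sub_bipartition_def
    by (auto dest!: bspec[of _ _ "Suc i"] simp: A_def B_def)
  have disj: "(A i \<union> B i) \<inter> (A j \<union> B j) = {}" if "i < k" "j < k" "i \<noteq> j" for i j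
  proof -
    have "Suc i \<in> {1..k}" "Suc j \<in> {1..k}" "Suc i \<noteq> Suc j" using that by auto
    then show ?thesis using V unfolding sub_bipartition_family_def conv[symmetric] by blast
  qed
  have fr: "frustration (\<chi> i) \<le> 2 * h * card (A i \<union> B i)" if "i < k" for i
  proof -
    have "bipartiteness_ratio \<Gamma> (\<lambda>_. 1) (A i) (B i) \<le> h" using h[of "Suc i"] that unfolding conv by simp
    moreover have "card (A i \<union> B i) > 0" using sub[OF that] by (auto simp: card_gt_0_iff intro: finite_subset)
    ultimately show ?thesis
      using sub[OF that] by (simp add: bipartiteness_ratio_conv \<chi>_def pos_divide_le_eq mult_ac)
  qed
  have abs: "\<bar>\<chi> i u\<bar> = of_bool (u \<in> A i \<union> B i)" "(\<chi> i u)\<^sup>2 = of_bool (u \<in> A i \<union> B i)" if "i < k" for i u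
    using sub(3)[OF that] by (auto simp: \<chi>_def signed_indicator_def)
  have one: "(\<Sum>i<k. \<bar>\<chi> i u\<bar>) \<le> 1" for u
  proof -
    have "(\<Sum>i<k. \<bar>\<chi> i u\<bar>) = real (card {i\<in>{..<k}. u \<in> A i \<union> B i})"
      by (simp add: abs of_bool_def sum.If_cases Int_def)
    moreover have "card {i\<in>{..<k}. u \<in> A i \<union> B i} \<le> 1"
      using disj by (auto simp: card_le_Suc0_iff_eq)
    ultimately show ?thesis by simp
  qed
  obtain a :: "nat \<Rightarrow> real" where a: "\<exists>i<k. a i \<noteq> 0"
      "\<And>j. j < k - 1 \<Longrightarrow> (\<Sum>i<k. (\<Sum>u<?n. e j u * \<chi> i u) * a i) = 0"
    using underdetermined_system[of k "\<lambda>j i. \<Sum>u<?n. e j u * \<chi> i u"] k by auto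
  define f where "f u = (\<Sum>i<k. a i * \<chi> i u)" for u
  have orth: "(\<Sum>u<?n. e j u * f u) = 0" if "j < k - 1" for j
  proof -
    have "(\<Sum>u<?n. e j u * f u) = (\<Sum>i<k. (\<Sum>u<?n. e j u * \<chi> i u) * a i)"
      unfolding f_def sum_distrib_left sum_distrib_right by (subst sum.swap) (simp add: mult_ac)
    then show ?thesis using a(2)[OF that] by simp
  qed
  \<comment> \<open>Eigenvectors are numbered from 0, so \<open>?l (k - 1)\<close> is the
    \<open>k\<close>-th eigenvalue, and the components of \<open>f\<close> below index
    \<open>k - 1\<close> vanish. The factor 2 reflects the ordered pairs in
    \<open>energy\<close>.\<close>
  have "2 * (?l (k - 1) * (\<Sum>u<?n. (f u)\<^sup>2)) \<le> energy f"
    unfolding en parseval[of f, symmetric] sum_distrib_left[of "?l (k - 1)"]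
  proof (intro mult_left_mono sum_mono)
    fix j assume "j \<in> {..<?n}"
    then show "?l (k - 1) * (\<Sum>u<?n. e j u * f u)\<^sup>2 \<le> ?l j * (\<Sum>u<?n. e j u * f u)\<^sup>2"
      using orth[of j] mono[of "k - 1" j] by (cases "j < k - 1") (auto intro: mult_right_mono)
  qed simp
  also have "energy f \<le> 2 * (\<Sum>i<k. (a i)\<^sup>2 * frustration (\<chi> i))"
    unfolding f_def by (rule energy_disjoint_le[OF one])
  also have "\<dots> \<le> 2 * (\<Sum>i<k. (a i)\<^sup>2 * (2 * h * card (A i \<union> B i)))"
    by (intro mult_left_mono sum_mono fr) auto
  also have "\<dots> = 2 * (2 * h * (\<Sum>i<k. (a i)\<^sup>2 * card (A i \<union> B i)))"
    by (simp add: sum_distrib_left mult_ac)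
  \<comment> \<open>Disjoint supports leave no cross terms in the square of
    \<open>f\<close>.\<close>
  also have "(\<Sum>i<k. (a i)\<^sup>2 * card (A i \<union> B i)) = (\<Sum>u<?n. (f u)\<^sup>2)"
  proof -
    have sq: "(f u)\<^sup>2 = (\<Sum>i<k. (a i)\<^sup>2 * (\<chi> i u)\<^sup>2)" for u
    proof (cases "\<exists>p<k. u \<in> A p \<union> B p")
      case True
      then obtain p where p: "p < k" "u \<in> A p \<union> B p" by blast
      have z: "\<chi> i u = 0" if "i < k" "i \<noteq> p" for i
        using disj[OF that(1) p(1) that(2)] p(2) by (auto simp: \<chi>_def signed_indicator_def)
      have "f u = a p * \<chi> p u"
        unfolding f_def using p(1) z by (subst sum.remove[of _ p]) (auto intro!: sum.neutral)
      moreover have "(\<Sum>i<k. (a i)\<^sup>2 * (\<chi> i u)\<^sup>2) = (a p)\<^sup>2 * (\<chi> p u)\<^sup>2"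
        using p(1) z by (subst sum.remove[of _ p]) (auto intro!: sum.neutral)
      ultimately show ?thesis by (simp add: power_mult_distrib)
    next
      case False
      then have "\<chi> i u = 0" if "i < k" for i using that by (auto simp: \<chi>_def signed_indicator_def)
      then show ?thesis by (simp add: f_def)
    qed
    have "(\<Sum>u<?n. (f u)\<^sup>2) = (\<Sum>i<k. (a i)\<^sup>2 * (\<Sum>u<?n. (\<chi> i u)\<^sup>2))"
      unfolding sq sum_distrib_left by (rule sum.swap)
    moreover have "(\<Sum>u<?n. (\<chi> i u)\<^sup>2) = card (A i \<union> B i)" if "i < k" for i
    proof -
      have "verts \<Gamma> \<inter> {u. u \<in> A i \<or> u \<in> B i} = A i \<union> B i" using sub[OF that] by auto
      then show ?thesis by (simp add: abs that of_bool_def sum.If_cases)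
    qed
    ultimately show ?thesis by simp
  qed
  finally have le: "?l (k - 1) * (\<Sum>u<?n. (f u)\<^sup>2) \<le> 2 * h * (\<Sum>u<?n. (f u)\<^sup>2)" by simp
  have "(\<Sum>u<?n. (f u)\<^sup>2) > 0"
  proof -
    obtain i where i: "i < k" "a i \<noteq> 0" using a(1) by blast
    have "finite (A i \<union> B i)" using sub(1,2)[OF i(1)] by (auto intro: finite_subset)
    then have "card (A i \<union> B i) > 0" using sub(4)[OF i(1)] by (simp add: card_gt_0_iff)
    then have "0 < (a i)\<^sup>2 * card (A i \<union> B i)" using i by (intro mult_pos_pos) auto
    also have "\<dots> \<le> (\<Sum>i<k. (a i)\<^sup>2 * card (A i \<union> B i))" using i by (intro member_le_sum) auto
    finally show ?thesis using \<open>(\<Sum>i<k. (a i)\<^sup>2 * card (A i \<union> B i)) = (\<Sum>u<?n. (f u)\<^sup>2)\<close> by simp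
  qed
  then show ?thesis using le k by simp
qed

lemma ratio_family_exists:
  assumes k: "1 \<le> k" "k \<le> nverts \<Gamma>"
  defines "R \<equiv> 600000 * real k ^ 5 * nth_eigenvalue k (signed_laplacian \<Gamma>)"
  shows "\<exists>V. sub_bipartition_family \<Gamma> k V \<and>
    (\<forall>i\<in>{1..k}. bipartiteness_ratio \<Gamma> (\<lambda>_. 1) (V (2 * i - 1)) (V (2 * i)) \<le> sqrt (max_deg \<Gamma> * R))"
    and "nth_eigenvalue k (signed_laplacian \<Gamma>) \<ge> 0"
proof -
  let ?n = "nverts \<Gamma>" and ?l = "\<lambda>i. nth_eigenvalue (Suc i) (signed_laplacian \<Gamma>)"
  obtain e :: "nat \<Rightarrow> nat \<Rightarrow> real" where
    ON: "\<And>i j. i < ?n \<Longrightarrow> j < ?n \<Longrightarrow> (\<Sum>u<?n. e i u * e j u) = of_bool (i = j)" and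
    en: "\<And>f. energy f = 2 * (\<Sum>i<?n. ?l i * (\<Sum>u<?n. e i u * f u)\<^sup>2)" and
    mono: "\<And>i j. i \<le> j \<Longrightarrow> j < ?n \<Longrightarrow> ?l i \<le> ?l j"
    by (rule laplacian_spectral) blast
  \<comment> \<open>An eigenvector has energy twice its eigenvalue, which yields both nonnegativity
    of the eigenvalues and the energy bound that \<open>localization\<close> assumes.\<close>
  have ee: "energy (e j) = 2 * ?l j" if "j < ?n" for j
    unfolding en using that by (simp add: ON of_bool_def if_distrib[of "\<lambda>x. x\<^sup>2"] if_distrib[of "\<lambda>x. _ * x"] cong: if_cong)
  have "?l (k - 1) \<ge> 0" using energy_nonneg[of "e (k - 1)"] ee[of "k - 1"] k by simp
  then show "nth_eigenvalue k (signed_laplacian \<Gamma>) \<ge> 0" using k by simp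
  define d where "d = max_deg \<Gamma>"
  have deg: "(\<Sum>v<?n. weight \<Gamma> u v) \<le> d" if "u \<in> verts \<Gamma>" for u
    using that unfolding d_def max_deg_def deg_def[symmetric] by (intro Max_ge) auto
  have d: "d \<ge> 0"
    using deg[of 0] k sum_nonneg[of "verts \<Gamma>" "weight \<Gamma> 0"] by (simp add: weight_nonneg)
  have mono': "?l i \<le> nth_eigenvalue k (signed_laplacian \<Gamma>)" if "i < k" for i
    using mono[of i "k - 1"] that k by simp
  have "\<exists>\<psi> :: nat \<Rightarrow> nat \<Rightarrow> real.
    (\<forall>g<k. (\<Sum>u<?n. (\<psi> g u)\<^sup>2) > 0 \<and> energy (\<psi> g) \<le> 600000 * real k ^ 5 * ?l (k - 1) * (\<Sum>u<?n. (\<psi> g u)\<^sup>2)) \<and>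
    (\<forall>g<k. \<forall>h<k. g \<noteq> h \<longrightarrow> (\<forall>u. \<psi> g u = 0 \<or> \<psi> h u = 0))"
    by (rule localization[of k e "?l (k - 1)"]) (use k in \<open>auto simp: ON ee intro!: mono'\<close>)
  then obtain \<psi> :: "nat \<Rightarrow> nat \<Rightarrow> real" where
    \<psi>: "\<forall>g<k. (\<Sum>u<?n. (\<psi> g u)\<^sup>2) > 0 \<and>
        energy (\<psi> g) \<le> 600000 * real k ^ 5 * ?l (k - 1) * (\<Sum>u<?n. (\<psi> g u)\<^sup>2)"
      "\<forall>g<k. \<forall>h<k. g \<noteq> h \<longrightarrow> (\<forall>u. \<psi> g u = 0 \<or> \<psi> h u = 0)" by (elim exE conjE) (rule that)
  have lk: "?l (k - 1) = nth_eigenvalue k (signed_laplacian \<Gamma>)" using k by simp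
  have pos: "(\<Sum>u<?n. (\<psi> g u)\<^sup>2) > 0" if "g < k" for g using \<psi>(1) that by blast
  have low: "energy (\<psi> g) \<le> R * (\<Sum>u<?n. (\<psi> g u)\<^sup>2)" if "g < k" for g
    using \<psi>(1) that unfolding R_def lk by blast
  have disj: "\<psi> g u = 0 \<or> \<psi> h u = 0" if "g < k" "h < k" "g \<noteq> h" for g h u
    using \<psi>(2) that by blast
  have "\<forall>g\<in>{..<k}. \<exists>t\<ge>0. (\<exists>u<?n. (\<psi> g u)\<^sup>2 > t) \<and> frustration (superlevel (\<psi> g) t) \<le>
      2 * sqrt (d * energy (\<psi> g) / (\<Sum>u<?n. (\<psi> g u)\<^sup>2)) * card {u\<in>verts \<Gamma>. (\<psi> g u)\<^sup>2 > t}"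
    using cheeger_rounding[OF deg pos] by (auto simp: Bex_def)
  from bchoice[OF this] obtain t where t: "\<forall>g\<in>{..<k}. t g \<ge> 0 \<and> (\<exists>u<?n. (\<psi> g u)\<^sup>2 > t g) \<and>
      frustration (superlevel (\<psi> g) (t g)) \<le>
      2 * sqrt (d * energy (\<psi> g) / (\<Sum>u<?n. (\<psi> g u)\<^sup>2)) * card {u\<in>verts \<Gamma>. (\<psi> g u)\<^sup>2 > t g}"
    by (rule exE)
  have t: "t g \<ge> 0" "\<exists>u<?n. (\<psi> g u)\<^sup>2 > t g"
    "frustration (superlevel (\<psi> g) (t g)) \<le>
      2 * sqrt (d * energy (\<psi> g) / (\<Sum>u<?n. (\<psi> g u)\<^sup>2)) * card {u\<in>verts \<Gamma>. (\<psi> g u)\<^sup>2 > t g}"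
    if "g < k" for g
    using t that by blast+
  define A where "A g = {u\<in>verts \<Gamma>. \<psi> g u > 0 \<and> (\<psi> g u)\<^sup>2 > t g}" for g
  define B where "B g = {u\<in>verts \<Gamma>. \<psi> g u < 0 \<and> (\<psi> g u)\<^sup>2 > t g}" for g
  have AB: "A g \<union> B g = {u\<in>verts \<Gamma>. (\<psi> g u)\<^sup>2 > t g}" if "g < k" for g
  proof -
    \<comment> \<open>Vertices of value 0 never exceed a threshold \<open>t g \<ge> 0\<close>, so
      splitting the superlevel set by sign loses nothing.\<close>
    have "\<psi> g u \<noteq> 0" if "(\<psi> g u)\<^sup>2 > t g" for u using that t(1)[OF \<open>g < k\<close>] by auto
    then show ?thesis by (auto simp: A_def B_def neq_iff)
  qed
  have ne: "A g \<union> B g \<noteq> {}" if "g < k" for g using t(2)[OF that] unfolding AB[OF that] by auto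
  have ratio: "bipartiteness_ratio \<Gamma> (\<lambda>_. 1) (A g) (B g) \<le> sqrt (d * R)" if g: "g < k" for g
  proof -
    have "frustration (signed_indicator (A g) (B g)) = frustration (superlevel (\<psi> g) (t g))"
      by (rule frustration_cong) (auto simp: signed_indicator_def superlevel_def A_def B_def sgn_if)
    also have "\<dots> \<le> 2 * sqrt (d * energy (\<psi> g) / (\<Sum>u<?n. (\<psi> g u)\<^sup>2)) * card (A g \<union> B g)"
      unfolding AB[OF g] by (rule t(3)[OF g])
    also have "\<dots> \<le> 2 * sqrt (d * R) * card (A g \<union> B g)"
    proof -
      have "energy (\<psi> g) / (\<Sum>u<?n. (\<psi> g u)\<^sup>2) \<le> R"
        using low[OF g] pos[OF g] by (simp add: pos_divide_le_eq)
      then have "d * (energy (\<psi> g) / (\<Sum>u<?n. (\<psi> g u)\<^sup>2)) \<le> d * R" using d by (rule mult_left_mono)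
      then show ?thesis by (intro mult_right_mono mult_left_mono) auto
    qed
    finally have "frustration (signed_indicator (A g) (B g)) \<le> sqrt (d * R) * (2 * card (A g \<union> B g))" by simp
    moreover have "card (A g \<union> B g) > 0" using ne[OF g] by (auto simp: card_gt_0_iff A_def B_def)
    ultimately show ?thesis
      by (subst bipartiteness_ratio_conv) (auto simp: pos_divide_le_eq, auto simp: A_def B_def)
  qed
  \<comment> \<open>The functions are numbered from 0 and the sub-bipartitions from 1: position
    \<open>2 * i - 1\<close> holds \<open>A (i - 1)\<close>, position \<open>2 * i\<close> holds
    \<open>B (i - 1)\<close>.\<close>
  define V where "V m = (if odd m then A (m div 2) else B (m div 2 - 1))" for m
  have V: "V (2 * i - 1) = A (i - 1)" "V (2 * i) = B (i - 1)" if i: "i \<in> {1..k}" for i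
  proof -
    obtain j where "i = Suc j" using i by (cases i) auto
    then show "V (2 * i - 1) = A (i - 1)" "V (2 * i) = B (i - 1)" by (simp_all add: V_def)
  qed
  have "sub_bipartition_family \<Gamma> k V"
    unfolding sub_bipartition_family_def sub_bipartition_def
  proof (intro conjI ballI impI)
    fix i assume i: "i \<in> {1..k}"
    then have "i - 1 < k" by auto
    then show "V (2 * i - 1) \<union> V (2 * i) \<noteq> {}" unfolding V[OF i] by (rule ne)
    show "V (2 * i - 1) \<subseteq> verts \<Gamma>" "V (2 * i) \<subseteq> verts \<Gamma>" "V (2 * i - 1) \<inter> V (2 * i) = {}"
      unfolding V[OF i] by (auto simp: A_def B_def)
    fix j assume j: "j \<in> {1..k}" and "i \<noteq> j"
    then have "i - 1 < k" "j - 1 < k" "i - 1 \<noteq> j - 1" using i by auto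
    then have "\<psi> (i - 1) u = 0 \<or> \<psi> (j - 1) u = 0" for u by (rule disj)
    moreover have "\<psi> g u \<noteq> 0" if "u \<in> A g \<union> B g" for g u using that by (auto simp: A_def B_def)
    ultimately show "(V (2 * i - 1) \<union> V (2 * i)) \<inter> (V (2 * j - 1) \<union> V (2 * j)) = {}"
      unfolding V[OF i] V[OF j] by (meson disjoint_iff)
  qed
  moreover have "\<forall>i\<in>{1..k}. bipartiteness_ratio \<Gamma> (\<lambda>_. 1) (V (2 * i - 1)) (V (2 * i)) \<le> sqrt (d * R)"
    using ratio V by auto
  ultimately show "\<exists>V. sub_bipartition_family \<Gamma> k V \<and>
    (\<forall>i\<in>{1..k}. bipartiteness_ratio \<Gamma> (\<lambda>_. 1) (V (2 * i - 1)) (V (2 * i)) \<le> sqrt (max_deg \<Gamma> * R))"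
    unfolding d_def by blast
qed

lemma cheeger_bounds:
  assumes k: "k \<in> {1..nverts \<Gamma>}"
  shows "nth_eigenvalue k (signed_laplacian \<Gamma>) / 2 \<le> cheeger \<Gamma> (\<lambda>_. 1) k"
    and "cheeger \<Gamma> (\<lambda>_. 1) k
         \<le> 1000 * real k ^ 3 * sqrt (max_deg \<Gamma> * nth_eigenvalue k (signed_laplacian \<Gamma>))"
proof -
  let ?l = "nth_eigenvalue k (signed_laplacian \<Gamma>)"
  let ?m = "\<lambda>V. Max ((\<lambda>i. bipartiteness_ratio \<Gamma> (\<lambda>_. 1) (V (2 * i - 1)) (V (2 * i))) ` {1..k})"
  let ?H = "{?m V | V. sub_bipartition_family \<Gamma> k V}"
  have fin: "finite ?H" using k by (intro cheeger_values_finite) auto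
  have ne: "?H \<noteq> {}" using family_exists[of k] k by auto
  have bound: "?l / 2 \<le> x" if "x \<in> ?H" for x
  proof -
    from that obtain V where V: "sub_bipartition_family \<Gamma> k V" "x = ?m V" by blast
    have "?l \<le> 2 * x"
      by (rule eigenvalue_le_ratio[OF _ _ V(1)]) (use k V(2) in \<open>auto intro!: Max_ge\<close>)
    then show ?thesis by simp
  qed
  show "?l / 2 \<le> cheeger \<Gamma> (\<lambda>_. 1) k"
    unfolding cheeger_def by (rule Min.boundedI[OF fin ne bound])
  obtain V where V: "sub_bipartition_family \<Gamma> k V"
    "\<forall>i\<in>{1..k}. bipartiteness_ratio \<Gamma> (\<lambda>_. 1) (V (2 * i - 1)) (V (2 * i)) \<le> sqrt (max_deg \<Gamma> * (600000 * real k ^ 5 * ?l))"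
    using ratio_family_exists(1)[of k] k by auto
  have l: "?l \<ge> 0" using ratio_family_exists(2)[of k] k by auto
  have d: "max_deg \<Gamma> \<ge> 0"
  proof -
    have "0 \<le> deg \<Gamma> 0" unfolding deg_def by (intro sum_nonneg weight_nonneg)
    also have "\<dots> \<le> max_deg \<Gamma>" unfolding max_deg_def using k by (intro Max_ge) auto
    finally show ?thesis .
  qed
  have "cheeger \<Gamma> (\<lambda>_. 1) k \<le> ?m V"
    unfolding cheeger_def using fin V(1) by (intro Min_le) auto
  also have "\<dots> \<le> sqrt (max_deg \<Gamma> * (600000 * real k ^ 5 * ?l))"
    using V(2) k by (intro Max.boundedI) auto
  also have "\<dots> \<le> sqrt ((1000 * real k ^ 3)\<^sup>2 * (max_deg \<Gamma> * ?l))"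
  proof (rule real_sqrt_le_mono)
    \<comment> \<open>The square root alone would give the exponent 5/2; raising the power to 6 and
      the factor to the square of 1000 makes the root explicit.\<close>
    have "600000 * real k ^ 5 \<le> 1000000 * real k ^ 6"
      using k by (intro mult_mono power_increasing) auto
    then have "600000 * real k ^ 5 * (max_deg \<Gamma> * ?l) \<le> 1000000 * real k ^ 6 * (max_deg \<Gamma> * ?l)"
      using d l by (intro mult_right_mono) auto
    then show "max_deg \<Gamma> * (600000 * real k ^ 5 * ?l) \<le> (1000 * real k ^ 3)\<^sup>2 * (max_deg \<Gamma> * ?l)"
      by (simp add: power_mult_distrib mult_ac flip: power_mult)
  qed
  also have "\<dots> = 1000 * real k ^ 3 * sqrt (max_deg \<Gamma> * ?l)"
    by (simp only: real_sqrt_mult real_sqrt_abs) simp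
  finally show "cheeger \<Gamma> (\<lambda>_. 1) k \<le> 1000 * real k ^ 3 * sqrt (max_deg \<Gamma> * ?l)" .
qed

end

theorem theorem5p4:
  shows "\<exists>C::real. \<forall>\<Gamma>. signed_graph \<Gamma> \<longrightarrow>
    (\<forall>k\<in>{1..nverts \<Gamma>}.
       nth_eigenvalue k (signed_laplacian \<Gamma>) / 2 \<le> cheeger \<Gamma> (\<lambda>_. 1) k \<and>
       cheeger \<Gamma> (\<lambda>_. 1) k
         \<le> C * real k ^ 3 * sqrt (max_deg \<Gamma> * nth_eigenvalue k (signed_laplacian \<Gamma>)))"
  using cheeger_bounds by blast

end
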